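(* Let $m\ge n$ and let $\boldsymbol{A}=\boldsymbol{A}_{\rm s}+\boldsymbol{A}_{\rm i}\epsilon\in\mathbb{DR}^{m\times n}$ be a dual matrix with $r=\mathrm{Rank}(\boldsymbol{A}_{\rm s})$ that has a compact dual singular value decomposition (CDSVD). Then for every $1\le p\le\infty$ and every $1\le k\le r$, the dual-valued Ky Fan $p$-$k$-norm of $\boldsymbol{A}$ equals the dual-valued vector $p$-norm of the vector $\boldsymbol{\sigma}^k\in\mathbb{DR}^k$ of its first $k$ singular values: $$\Vert\boldsymbol{A}\Vert_{(k,p)}=\Vert\boldsymbol{\sigma}^k\Vert_p.$$
   Context: Dual numbers: $\mathbb{DR}=\{p_{\rm s}+p_{\rm i}\epsilon: p_{\rm s},p_{\rm i}\in\mathbb{R}\}$ with $\epsilon\neq0$, $\epsilon^2=0$ (a commutative ring), with total order $p<q$ if $p_{\rm s}<q_{\rm s}$, or $p_{\rm s}=q_{\rm s}$ and $p_{\rm i}<q_{\rm i}$. Dual vectors and matrices are written $\boldsymbol{A}=\boldsymbol{A}_{\rm s}+\boldsymbol{A}_{\rm i}\epsilon$ with $\boldsymbol{A}_{\rm s},\boldsymbol{A}_{\rm i}$ real. CDSVD: $\boldsymbol{A}\in\mathbb{DR}^{m\times n}$ with $r=\mathrm{Rank}(\boldsymbol{A}_{\rm s})$ has a CDSVD if $\boldsymbol{A}=\boldsymbol{U}\boldsymbol{\Sigma}\boldsymbol{V}^\top$ with $\boldsymbol{U}\in\mathbb{DR}^{m\times r}$, $\boldsymbol{V}\in\mathbb{DR}^{n\times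 r}$ having orthogonal columns ($\boldsymbol{U}^\top\boldsymbol{U}=\boldsymbol{V}^\top\boldsymbol{V}=\boldsymbol{I}_r$) and $\boldsymbol{\Sigma}\in\mathbb{DR}^{r\times r}$ diagonal with positive diagonal entries. The diagonal entries of $\boldsymbol{\Sigma}$ are the singular values of $\boldsymbol{A}$, listed in nonincreasing order with respect to the total order (standard parts nonincreasing, and infinitesimal parts nonincreasing within each group of equal standard parts). Gâteaux derivative: $\mathcal{D}_u\phi(x)=\lim_{t\downarrow0}\frac{\phi(x+tu)-\phi(x)}{t}$. The dual continuation of a real-valued function $\phi$ on a real space $\mathcal{X}$ is $\tilde\phi(a+b\epsilon)=\phi(a)+\mathcal{D}_b\phi(a)\,\epsilon$ for $a,b\in\mathcal{X}$. The dual-valued Ky Fan $p$-$k$-norm $\Vert\cdot\Vert_{(k,p)}$ and the dual-valued vector $p$-norm $\Vert\cdot\Vert_p$ are the dual continuations of the real ones: for $\boldsymbol{X}\in\mathbb{R}^{m\times n}$ with singular values $\sigma_1\ge\cdots\ge\sigma_n$, $\Vert\boldsymbol{X}\Vert_{(k,p)}=(\sum_{i=1}^k\sigma_i^p)^{1/p}$ for $1\le p<\infty$ and $\Vert\boldsymbol{X}\Vert_{(k,\infty)}=\sigma_1$; for $\boldsymbol{y}\in\mathbb{R}^k$, $\Vert\boldsymbol{y}\Vert_p=(\sum_i|y_i|^p)^{1/p}$ for $1\le p<\infty$ and $\Vert\boldsymbol{y}\Vert_\infty=\max_i|y_i|$. *)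

theory Defs
  imports "HOL-Analysis.Analysis" "Jordan_Normal_Form.DL_Rank" "Jordan_Normal_Form.Char_Poly"
begin

datatype dual = Dual (std_part: real) (inf_part: real)

lemma dual_eqI: "std_part p = std_part q \<Longrightarrow> inf_part p = inf_part q \<Longrightarrow> p = q"
  by (rule dual.expand) simp

instantiation dual :: comm_ring_1
begin

definition "0 = Dual 0 0"
definition "1 = Dual 1 0"
definition "p + q = Dual (std_part p + std_part q) (inf_part p + inf_part q)"
definition "p - q = Dual (std_part p - std_part q) (inf_part p - inf_part q)"
definition "- p = Dual (- std_part p) (- inf_part p)"
definition "p * q = Dual (std_part p * std_part q)
                         (std_part p * inf_part q + inf_part p * std_part q)"

instance
  by standard
    (auto intro!: dual_eqI simp: zero_dual_def one_dual_def plus_dual_def minus_dual_def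
      uminus_dual_def times_dual_def algebra_simps)

end

instantiation dual :: linorder
begin

definition "p < q \<longleftrightarrow>
  std_part p < std_part q \<or> std_part p = std_part q \<and> inf_part p < inf_part q"

definition "(p::dual) \<le> q \<longleftrightarrow> p < q \<or> p = q"

instance
  by standard (auto simp: less_dual_def less_eq_dual_def dual_eqI intro: dual_eqI)

end

definition dual_eps :: dual where
  "dual_eps = Dual 0 1"

lemma dual_eps_square: "dual_eps * dual_eps = 0"
  by (simp add: dual_eps_def times_dual_def zero_dual_def)

lemma dual_decomp: "Dual a b = Dual a 0 + Dual b 0 * dual_eps"
  by (simp add: dual_eps_def times_dual_def plus_dual_def)

definition is_CDSVD :: "dual mat \<Rightarrow> dual mat \<Rightarrow> dual mat \<Rightarrow> dual mat \<Rightarrow> bool" where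
  "is_CDSVD A U S V \<longleftrightarrow>
     (let m = dim_row A; n = dim_col A; r = vec_space.rank m (map_mat std_part A) in
      U \<in> carrier_mat m r \<and> S \<in> carrier_mat r r \<and> V \<in> carrier_mat n r \<and>
      U\<^sup>T * U = 1\<^sub>m r \<and> V\<^sup>T * V = 1\<^sub>m r \<and>
      diagonal_mat S \<and> (\<forall>i<r. 0 < S $$ (i, i)) \<and>
      A = U * S * V\<^sup>T)"

text \<open>The diagonal of the middle factor of a CDSVD, in nonincreasing order. The order on dual
  numbers is the lexicographic one, so infinitesimal parts are nonincreasing within each group of
  equal standard parts.\<close>

definition dual_singular_values :: "dual mat \<Rightarrow> dual list" where
  "dual_singular_values S = rev (sort (diag_mat S))"

definition leading_vec :: "nat \<Rightarrow> 'a list \<Rightarrow> 'a vec" where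
  "leading_vec k xs = vec k (\<lambda>i. xs ! i)"

text \<open>The spaces of real vectors and matrices of a given size are carrier sets of the types
  \<^typ>\<open>real vec\<close> and \<^typ>\<open>real mat\<close>, which are not instances of \<^class>\<open>real_vector\<close>; hence
  scalar multiplication is a parameter here. The continuation takes the standard and the
  infinitesimal part of its argument separately. It is applied to norms only: these are convex,
  so that the one-sided limit always exists.\<close>

definition gateaux_deriv ::
  "(real \<Rightarrow> 'a \<Rightarrow> 'a) \<Rightarrow> ('a::plus \<Rightarrow> real) \<Rightarrow> 'a \<Rightarrow> 'a \<Rightarrow> real" where
  "gateaux_deriv sc \<phi> u x = Lim (at_right 0) (\<lambda>t. (\<phi> (x + sc t u) - \<phi> x) / t)"

definition dual_continuation ::
  "(real \<Rightarrow> 'a \<Rightarrow> 'a) \<Rightarrow> ('a::plus \<Rightarrow> real) \<Rightarrow> 'a \<Rightarrow> 'a \<Rightarrow> dual" where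
  "dual_continuation sc \<phi> a b = Dual (\<phi> a) (gateaux_deriv sc \<phi> b a)"

text \<open>The square roots of the eigenvalues of \<open>X\<^sup>T X\<close>, counted with multiplicity.\<close>

definition singular_values :: "real mat \<Rightarrow> real list" where
  "singular_values X =
     rev (sorted_list_of_multiset (image_mset sqrt (proots (char_poly (X\<^sup>T * X)))))"

text \<open>Singular values and vector entries are indexed from 0. The exponent \<open>p\<close> ranges over
  \<open>[1, \<infinity>]\<close>.\<close>

definition ky_fan_norm :: "nat \<Rightarrow> ereal \<Rightarrow> real mat \<Rightarrow> real" where
  "ky_fan_norm k p X =
     (if p = \<infinity> then singular_values X ! 0
      else (\<Sum>i<k. (singular_values X ! i) powr real_of_ereal p) powr (1 / real_of_ereal p))"

definition vec_p_norm :: "ereal \<Rightarrow> real vec \<Rightarrow> real" where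
  "vec_p_norm p y =
     (if p = \<infinity> then Max ((\<lambda>i. \<bar>y $ i\<bar>) ` {..<dim_vec y})
      else (\<Sum>i<dim_vec y. \<bar>y $ i\<bar> powr real_of_ereal p) powr (1 / real_of_ereal p))"

definition dual_ky_fan_norm :: "nat \<Rightarrow> ereal \<Rightarrow> dual mat \<Rightarrow> dual" where
  "dual_ky_fan_norm k p A =
     dual_continuation (\<cdot>\<^sub>m) (ky_fan_norm k p) (map_mat std_part A) (map_mat inf_part A)"

definition dual_vec_p_norm :: "ereal \<Rightarrow> dual vec \<Rightarrow> dual" where
  "dual_vec_p_norm p y =
     dual_continuation (\<cdot>\<^sub>v) (vec_p_norm p) (map_vec std_part y) (map_vec inf_part y)"

end

theory Submission
  imports Defs
begin

text \<open>The infinitesimal part of a dual continuation is a one-sided derivative along the line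
  \<open>t \<mapsto> a + t b\<close>, so both sides of the claim compare real functions of a small real \<open>t > 0\<close>. Two such
  functions that agree at \<open>t = 0\<close> and differ by \<open>O(t\<^sup>2)\<close> have the same derivative
  (\<open>gateaux_deriv_cong_to_first_order\<close>). The proof therefore shows that the Ky Fan norm of
  \<open>X(t) = A\<^sub>s + t A\<^sub>i\<close> and the \<open>p\<close>-norm of \<open>s(t) = \<sigma>\<^sub>s + t \<sigma>\<^sub>i\<close> agree up to \<open>O(t\<^sup>2)\<close>.

  Substituting a real \<open>t\<close> for the infinitesimal unit in \<open>A = U S V\<^sup>T\<close> respects products modulo
  \<open>t\<^sup>2\<close>. Hence \<open>U(t) = U\<^sub>s + t U\<^sub>i\<close> and \<open>V(t)\<close> have columns that are orthonormal up to \<open>O(t\<^sup>2)\<close>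
  (\<open>orthonormal_to_first_order\<close>), and \<open>X(t)\<close> differs from \<open>U(t) S(t) V(t)\<^sup>T\<close> by \<open>O(t\<^sup>2)\<close>
  (\<open>factorisation_to_first_order\<close>): the real matrix \<open>X(t)\<close> almost has a singular value
  decomposition with the numbers \<open>s\<^sub>j(t)\<close>. The min-max principle turns this into
  \<open>\<sigma>\<^sub>j(X(t)) = s\<^sub>j(t) + O(t\<^sup>2)\<close> (\<open>approximate_svd_singular_values\<close>, \<open>singular_value_first_order\<close>), as
  soon as the \<open>s\<^sub>j(t)\<close> are nonnegative and listed in nonincreasing order. That is where the order of
  dual numbers enters: it is lexicographic, so \<open>x \<le> y\<close> gives
  \<open>x\<^sub>s + t x\<^sub>i \<le> y\<^sub>s + t y\<^sub>i\<close> for all small \<open>t > 0\<close> (\<open>eventually_dual_le\<close>), also inside a group of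
  equal standard parts, where the infinitesimal parts decide which value is larger. Finally the
  \<open>p\<close>-norm is Lipschitz (\<open>pnorm_lipschitz\<close>, from Minkowski's inequality), which carries the
  estimate over to the norms.

  The singular values are defined as square roots of the roots of the characteristic polynomial of
  \<open>X\<^sup>T X\<close>. To reach the min-max principle, an orthonormal basis is built by maximising \<open>\<bar>X x\<bar>\<close>
  repeatedly on the unit sphere of the orthogonal complement of the vectors already chosen
  (\<open>singular_vectors_exist\<close>). This basis diagonalises \<open>X\<^sup>T X\<close>, which identifies the maxima with the
  singular values (\<open>singular_values_eq\<close>), and the maximality is the upper half of the min-max
  principle.\<close>

section \<open>Real vectors and matrices as functions\<close>

text \<open>The numbers of rows and columns are values rather than types, and most of the argument is about
  finite sums. Vectors are therefore functions on the natural numbers of which only the entries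
  below an explicit bound count, and matrices are functions of two indices.\<close>

definition dot :: "nat \<Rightarrow> (nat \<Rightarrow> real) \<Rightarrow> (nat \<Rightarrow> real) \<Rightarrow> real" where
  "dot n x y = (\<Sum>i<n. x i * y i)"

definition nrm :: "nat \<Rightarrow> (nat \<Rightarrow> real) \<Rightarrow> real" where
  "nrm n x = L2_set x {..<n}"

definition mapply :: "nat \<Rightarrow> (nat \<Rightarrow> nat \<Rightarrow> real) \<Rightarrow> (nat \<Rightarrow> real) \<Rightarrow> nat \<Rightarrow> real" where
  "mapply n X x = (\<lambda>i. \<Sum>j<n. X i j * x j)"

abbreviation entries :: "'a mat \<Rightarrow> nat \<Rightarrow> nat \<Rightarrow> 'a" where
  "entries X \<equiv> \<lambda>a b. X $$ (a, b)"

lemma dot_commute: "dot n x y = dot n y x"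
  by (simp add: dot_def mult.commute)

lemma dot_add_right: "dot n x (\<lambda>i. y i + z i) = dot n x y + dot n x z"
  by (simp add: dot_def algebra_simps sum.distrib)

lemma dot_scale_right: "dot n x (\<lambda>i. c * y i) = c * dot n x y"
  by (simp add: dot_def algebra_simps sum_distrib_left)

lemma dot_add_left: "dot n (\<lambda>i. y i + z i) x = dot n y x + dot n z x"
  by (simp add: dot_def algebra_simps sum.distrib)

lemma dot_scale_left: "dot n (\<lambda>i. c * y i) x = c * dot n y x"
  by (simp add: dot_def algebra_simps sum_distrib_left)

lemma dot_sum_left: "dot n (\<lambda>i. \<Sum>l\<in>L. f l i) y = (\<Sum>l\<in>L. dot n (f l) y)"
  unfolding dot_def by (subst sum.swap) (simp add: sum_distrib_right)

lemma dot_sum_right: "dot n y (\<lambda>i. \<Sum>l\<in>L. f l i) = (\<Sum>l\<in>L. dot n y (f l))"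
  using dot_sum_left[of n f L y] by (simp add: dot_commute)

lemmas dot_linear = dot_add_left dot_add_right dot_scale_left dot_scale_right

lemma dot_self: "dot n x x = (nrm n x)\<^sup>2"
  by (simp add: dot_def nrm_def L2_set_def sum_nonneg power2_eq_square[symmetric])

lemma nrm_nonneg [simp]: "0 \<le> nrm n x"
  by (simp add: nrm_def)

lemma nrm_eq_0_iff: "nrm n x = 0 \<longleftrightarrow> (\<forall>i<n. x i = 0)"
  by (auto simp: nrm_def L2_set_eq_0_iff)

lemma dot_le_nrm: "dot n x y \<le> nrm n x * nrm n y"
proof -
  have "dot n x y \<le> (\<Sum>i<n. \<bar>x i\<bar> * \<bar>y i\<bar>)"
    unfolding dot_def by (intro sum_mono) (metis abs_ge_self abs_mult)
  also have "\<dots> \<le> nrm n x * nrm n y"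
    unfolding nrm_def by (rule L2_set_mult_ineq)
  finally show ?thesis .
qed

lemma nrm_triangle: "nrm n (\<lambda>i. x i + y i) \<le> nrm n x + nrm n y"
  unfolding nrm_def by (rule L2_set_triangle_ineq)

lemma nrm_scale: "nrm n (\<lambda>i. c * x i) = \<bar>c\<bar> * nrm n x"
  by (simp add: nrm_def L2_set_def power_mult_distrib sum_distrib_left[symmetric] real_sqrt_mult)

lemma nrm_cong: "(\<And>i. i < n \<Longrightarrow> x i = y i) \<Longrightarrow> nrm n x = nrm n y"
  by (auto simp: nrm_def intro!: L2_set_cong)

lemma mapply_add: "mapply n X (\<lambda>j. x j + y j) = (\<lambda>i. mapply n X x i + mapply n X y i)"
  by (simp add: mapply_def algebra_simps sum.distrib)

lemma mapply_scale: "mapply n X (\<lambda>j. c * x j) = (\<lambda>i. c * mapply n X x i)"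
  by (simp add: mapply_def algebra_simps sum_distrib_left)

lemma mapply_sum: "mapply n X (\<lambda>j. \<Sum>l\<in>L. f l j) = (\<lambda>i. \<Sum>l\<in>L. mapply n X (f l) i)"
  unfolding mapply_def by (subst sum.swap) (simp add: sum_distrib_left)

lemma mapply_cong: "(\<And>j. j < n \<Longrightarrow> x j = y j) \<Longrightarrow> mapply n X x = mapply n X y"
  by (auto simp: mapply_def)

lemma dot_mapply:
  "dot m (mapply n X x) y = dot n x (mapply m (\<lambda>j i. X i j) y)"
  unfolding dot_def mapply_def
  by (simp add: sum_distrib_left sum_distrib_right)
     (subst sum.swap, simp add: mult_ac)

section \<open>An orthonormal basis of singular vectors\<close>

text \<open>Padding the system with zero equations makes it square with a vanishing determinant.\<close>

lemma homogeneous_solution: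
  assumes "k < n"
  obtains x where "\<forall>j\<ge>n. x j = 0" "\<exists>j<n. x j \<noteq> 0" "\<forall>i<k. dot n (a i) x = 0"
proof -
  define c where "c i = vec n (\<lambda>j. if i < k then a i j else 0)" for i
  define C where "C = mat\<^sub>r n n (\<lambda>i. if i = k then 0\<^sub>v n else c i)"
  have C: "C \<in> carrier_mat n n" by (simp add: C_def)
  have "det C = 0"
    unfolding C_def by (rule det_row_0[OF assms]) (auto simp: c_def)
  then obtain v where v: "v \<in> carrier_vec n" "v \<noteq> 0\<^sub>v n" "C *\<^sub>v v = 0\<^sub>v n"
    using det_0_iff_vec_prod_zero[OF C] by auto
  define x where "x j = (if j < n then v $ j else 0)" for j
  have "\<exists>j<n. x j \<noteq> 0"
  proof (rule ccontr)
    assume "\<not> ?thesis"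
    then have "v $ j = 0" if "j < n" for j using that by (auto simp: x_def)
    then have "v = 0\<^sub>v n" using v(1) by (intro eq_vecI) auto
    then show False using v(2) by simp
  qed
  moreover have "dot n (a i) x = 0" if "i < k" for i
  proof -
    have "0 = (C *\<^sub>v v) $ i" using v(3) that assms by simp
    also have "\<dots> = (\<Sum>j<n. C $$ (i, j) * v $ j)"
      using that assms C v(1) by (simp add: scalar_prod_def lessThan_atLeast0)
    also have "\<dots> = dot n (a i) x"
      unfolding dot_def using that assms by (intro sum.cong) (auto simp: C_def c_def x_def)
    finally show ?thesis by simp
  qed
  moreover have "\<forall>j\<ge>n. x j = 0" by (simp add: x_def)
  ultimately show ?thesis using that by blast
qed

text \<open>The unit sphere of the orthogonal complement of \<open>v 0, \<dots>, v (k - 1)\<close> is nonempty because \<open>k < n\<close>,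
  and it is compact by Tychonov's theorem once the entries from \<open>n\<close> on are fixed to be zero.\<close>

lemma constrained_maximizer:
  assumes "k < n"
  obtains x where "nrm n x = 1" "\<forall>i<k. dot n (v i) x = 0"
    "\<And>y. \<forall>i<k. dot n (v i) y = 0 \<Longrightarrow> nrm m (mapply n X y) \<le> nrm m (mapply n X x) * nrm n y"
proof -
  define K where "K = {x. (\<forall>j\<ge>n. x j = 0) \<and> dot n x x = 1 \<and> (\<forall>i<k. dot n (v i) x = 0)}"
  define B where "B = (\<Pi>\<^sub>E j\<in>UNIV. if j < n then {-1..1::real} else {0})"
  note cont = continuous_on_product_coordinates
  have "compactin (product_topology (\<lambda>_::nat. euclidean) UNIV) B"
    unfolding B_def compactin_PiE by auto
  then have "compact B" by (simp add: euclidean_product_topology)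
  moreover have "closed K"
  proof -
    have "K = (\<Inter>j\<in>{n..}. {x. x j = 0}) \<inter> {x. dot n x x = 1} \<inter> (\<Inter>i\<in>{..<k}. {x. dot n (v i) x = 0})"
      by (auto simp: K_def)
    moreover have "closed \<dots>"
      unfolding dot_def
      by (intro closed_Int closed_INT ballI closed_Collect_eq continuous_intros cont)
    ultimately show ?thesis by simp
  qed
  moreover have "K \<subseteq> B"
  proof
    fix x assume x: "x \<in> K"
    have "\<bar>x j\<bar> \<le> 1" if "j < n" for j
    proof -
      have "x j * x j \<le> (\<Sum>i<n. x i * x i)"
        using that by (intro member_le_sum) auto
      then have "(x j)\<^sup>2 \<le> 1" using x by (simp add: K_def dot_def power2_eq_square)
      then show ?thesis by (simp add: abs_square_le_1)
    qed
    then show "x \<in> B" using x by (auto simp: B_def K_def abs_le_iff)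
  qed
  ultimately have comp: "compact K" by (metis closed_Int_compact inf.absorb_iff1)
  have normalise: "(\<lambda>j. (1 / nrm n y) * (if j < n then y j else 0)) \<in> K"
    if "\<forall>i<k. dot n (v i) y = 0" "nrm n y \<noteq> 0" for y
  proof -
    let ?z = "\<lambda>j. if j < n then y j else 0"
    have "nrm n ?z = nrm n y" by (rule nrm_cong) auto
    moreover have "dot n (v i) ?z = dot n (v i) y" for i
      unfolding dot_def by (rule sum.cong) auto
    ultimately show ?thesis using that
      unfolding K_def mem_Collect_eq dot_scale_left dot_scale_right
      by (auto simp: dot_self power2_eq_square)
  qed
  obtain y where y: "\<exists>j<n. y j \<noteq> 0" "\<forall>i<k. dot n (v i) y = 0"
    using homogeneous_solution[OF assms] by metis
  then have "K \<noteq> {}" using normalise[of y] by (auto simp: nrm_eq_0_iff)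
  moreover have "continuous_on K (\<lambda>x. nrm m (mapply n X x))"
    unfolding nrm_def L2_set_def mapply_def
    by (intro continuous_intros continuous_on_subset[OF cont]) auto
  ultimately obtain x where x: "x \<in> K" "\<And>y. y \<in> K \<Longrightarrow> nrm m (mapply n X y) \<le> nrm m (mapply n X x)"
    using continuous_attains_sup[OF comp] by metis
  show ?thesis
  proof
    have "(nrm n x)\<^sup>2 = 1" using x(1) by (simp add: K_def dot_self)
    then show "nrm n x = 1" by (metis nrm_nonneg power2_eq_1_iff neg_0_le_iff_le not_one_le_zero)
    show "\<forall>i<k. dot n (v i) x = 0" using x(1) by (simp add: K_def)
    fix y assume y: "\<forall>i<k. dot n (v i) y = 0"
    show "nrm m (mapply n X y) \<le> nrm m (mapply n X x) * nrm n y"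
    proof (cases "nrm n y = 0")
      case True
      then have "nrm m (mapply n X y) = 0"
        by (simp add: nrm_eq_0_iff mapply_def)
      then show ?thesis using True by simp
    next
      case False
      have "nrm m (mapply n X y) / nrm n y
          = nrm m (mapply n X (\<lambda>j. (1 / nrm n y) * (if j < n then y j else 0)))"
        unfolding mapply_scale nrm_scale
        by (simp add: mapply_cong[of n "\<lambda>j. if j < n then y j else 0" y])
      also have "\<dots> \<le> nrm m (mapply n X x)"
        using x(2) normalise[OF y False] by blast
      finally show ?thesis using False nrm_nonneg[of n y] by (simp add: field_simps)
    qed
  qed
qed

text \<open>A first-order condition: a linear term would dominate the quadratic one near \<open>t = 0\<close>
  and be negative on one side.\<close>

lemma nonneg_quadratic_no_linear_term:
  fixes b c :: real
  assumes "\<And>t. 0 \<le> 2 * t * b + t\<^sup>2 * c"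
  shows "b = 0"
proof (rule ccontr)
  assume "b \<noteq> 0"
  \<comment> \<open>At \<open>t = - b / d\<close> the expression is negative because \<open>b \<noteq> 0\<close>, \<open>d > 0\<close> and \<open>c < 2 d\<close>.\<close>
  define d where "d = \<bar>c\<bar> + 1"
  have d: "d > 0" "c < 2 * d" by (auto simp: d_def)
  have "0 \<le> 2 * (- b / d) * b + (- b / d)\<^sup>2 * c" by (rule assms)
  also have "\<dots> = (b / d)\<^sup>2 * (c - 2 * d)" using d by (simp add: field_simps power2_eq_square)
  also have "\<dots> < 0" using d \<open>b \<noteq> 0\<close> by (intro mult_pos_neg) auto
  finally show False by simp
qed

text \<open>Let \<open>x\<close> maximise \<open>\<bar>X x\<bar>\<close> on a unit sphere and \<open>M\<close> be the maximum. The quadratic form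
  \<open>M\<^sup>2 \<bar>z\<bar>\<^sup>2 - \<bar>X z\<bar>\<^sup>2\<close> is nonnegative on the subspace and vanishes at \<open>x\<close>, so its derivative at \<open>x\<close> in
  the direction \<open>y\<close> vanishes as well; for \<open>y\<close> orthogonal to \<open>x\<close> this says that \<open>X x\<close> and \<open>X y\<close> are
  orthogonal.\<close>

lemma maximizer_orthogonal:
  assumes unit: "nrm n x = 1" and x: "\<forall>i<k. dot n (v i) x = 0"
    and max: "\<And>y. \<forall>i<k. dot n (v i) y = 0 \<Longrightarrow> nrm m (mapply n X y) \<le> nrm m (mapply n X x) * nrm n y"
    and y: "\<forall>i<k. dot n (v i) y = 0" and xy: "dot n x y = 0"
  shows "dot m (mapply n X x) (mapply n X y) = 0"
proof -
  define M where "M = nrm m (mapply n X x)"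
  let ?b = "dot m (mapply n X x) (mapply n X y)"
  have "0 \<le> 2 * t * (- ?b) + t\<^sup>2 * (M\<^sup>2 * dot n y y - dot m (mapply n X y) (mapply n X y))" for t
  proof -
    let ?z = "\<lambda>j. x j + t * y j"
    have "nrm m (mapply n X ?z) \<le> M * nrm n ?z"
      unfolding M_def using x y by (intro max) (simp add: dot_linear)
    then have "(nrm m (mapply n X ?z))\<^sup>2 \<le> (M * nrm n ?z)\<^sup>2" by (intro power_mono) auto
    then have "dot m (mapply n X ?z) (mapply n X ?z) \<le> M\<^sup>2 * dot n ?z ?z"
      by (simp add: dot_self power_mult_distrib)
    moreover have "dot n ?z ?z = 1 + t\<^sup>2 * dot n y y"
      using unit xy dot_commute[of n x y]
      by (simp add: dot_linear dot_self[of n x] power2_eq_square algebra_simps)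
    moreover have "dot m (mapply n X ?z) (mapply n X ?z)
        = M\<^sup>2 + 2 * t * ?b + t\<^sup>2 * dot m (mapply n X y) (mapply n X y)"
      using dot_commute[of m "mapply n X x" "mapply n X y"]
      by (simp add: mapply_add mapply_scale dot_linear dot_self[of m "mapply n X x"] M_def
          power2_eq_square algebra_simps)
    ultimately show ?thesis by (simp add: algebra_simps)
  qed
  then have "- ?b = 0" by (rule nonneg_quadratic_no_linear_term)
  then show ?thesis by simp
qed

text \<open>Each vector is a maximiser on the orthogonal complement of its predecessors. The later vectors lie
  in that complement, so the images under \<open>X\<close> are orthogonal by the previous lemma.\<close>

lemma singular_vectors_exist:
  obtains v where
    "\<And>i l. i < n \<Longrightarrow> l < n \<Longrightarrow> dot n (v i) (v l) = (if i = l then 1 else 0)"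
    "\<And>i l. i < n \<Longrightarrow> l < n \<Longrightarrow> i \<noteq> l \<Longrightarrow> dot m (mapply n X (v i)) (mapply n X (v l)) = 0"
    "\<And>i y. i < n \<Longrightarrow> \<forall>l<i. dot n (v l) y = 0 \<Longrightarrow>
       nrm m (mapply n X y) \<le> nrm m (mapply n X (v i)) * nrm n y"
proof -
  define P where "P v i \<longleftrightarrow> nrm n (v i) = 1 \<and> (\<forall>l<i. dot n (v l) (v i) = 0) \<and>
      (\<forall>y. (\<forall>l<i. dot n (v l) y = 0) \<longrightarrow>
        nrm m (mapply n X y) \<le> nrm m (mapply n X (v i)) * nrm n y)" for v and i :: nat
  have "k \<le> n \<Longrightarrow> \<exists>v. \<forall>i<k. P v i" for k
  proof (induction k)
    case (Suc k)
    then obtain v where v: "\<forall>i<k. P v i" by auto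
    obtain x where x: "nrm n x = 1" "\<forall>i<k. dot n (v i) x = 0"
      "\<And>y. \<forall>i<k. dot n (v i) y = 0 \<Longrightarrow> nrm m (mapply n X y) \<le> nrm m (mapply n X x) * nrm n y"
      using Suc.prems constrained_maximizer[of k n v m X] by (metis Suc_le_lessD)
    have "\<forall>i<Suc k. P (v(k := x)) i"
      using v x by (auto simp: P_def less_Suc_eq)
    then show ?case by blast
  qed simp
  then obtain v where "\<forall>i<n. P v i" by blast
  then have unit: "nrm n (v i) = 1" and orth: "\<And>l. l < i \<Longrightarrow> dot n (v l) (v i) = 0"
    and max: "\<And>y. \<forall>l<i. dot n (v l) y = 0 \<Longrightarrow>
        nrm m (mapply n X y) \<le> nrm m (mapply n X (v i)) * nrm n y" if "i < n" for i
    using that by (auto simp: P_def)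
  have images: "dot m (mapply n X (v i)) (mapply n X (v l)) = 0" if "i < l" "l < n" for i l
    using that unit[of i] orth[of i] orth[of l] max[of i]
    by (intro maximizer_orthogonal[where k = i and v = v]) auto
  show ?thesis
  proof
    fix i l assume il: "i < n" "l < n"
    show "dot n (v i) (v l) = (if i = l then 1 else 0)"
      using il unit orth dot_commute[of n "v i" "v l"]
      by (cases i l rule: linorder_cases) (auto simp: dot_self)
    show "dot m (mapply n X (v i)) (mapply n X (v l)) = 0" if "i \<noteq> l"
      using il that images dot_commute[of m "mapply n X (v i)"] by (metis linorder_neqE_nat)
  next
    fix i y assume "i < n" "\<forall>l<i. dot n (v l) y = 0"
    then show "nrm m (mapply n X y) \<le> nrm m (mapply n X (v i)) * nrm n y" by (rule max)
  qed
qed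

lemma proots_linear_factors: "proots (\<Prod>a\<leftarrow>as. [:- a, 1:]) = mset (as :: real list)"
proof (induction as)
  case (Cons a as)
  have "(\<Prod>a\<leftarrow>as. [:- a, 1:]) \<noteq> 0" by (auto simp: prod_list_zero_iff)
  then show ?case using Cons by (simp add: proots_mult del: mult_pCons_left)
qed simp

text \<open>The matrix \<open>P\<close> with columns \<open>v i\<close> is orthogonal and \<open>P\<^sup>T X\<^sup>T X P\<close> is diagonal with the entries
  \<open>\<bar>X (v i)\<bar>\<^sup>2\<close>. By similarity these are the roots of the characteristic polynomial, with
  multiplicities, and they already come in nonincreasing order.\<close>

lemma singular_values_eq:
  assumes X: "X \<in> carrier_mat m n"
    and orth: "\<And>i l. i < n \<Longrightarrow> l < n \<Longrightarrow> dot n (v i) (v l) = (if i = l then 1 else 0)"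
    and images: "\<And>i l. i < n \<Longrightarrow> l < n \<Longrightarrow> i \<noteq> l \<Longrightarrow>
      dot m (mapply n (entries X) (v i)) (mapply n (entries X) (v l)) = 0"
    and decreasing: "\<And>i l. i \<le> l \<Longrightarrow> l < n \<Longrightarrow>
      nrm m (mapply n (entries X) (v l)) \<le> nrm m (mapply n (entries X) (v i))"
  shows "singular_values X = map (\<lambda>i. nrm m (mapply n (entries X) (v i))) [0..<n]"
proof -
  let ?s = "\<lambda>i. nrm m (mapply n (entries X) (v i))"
  define P where "P = mat n n (\<lambda>(a, i). v i a)"
  define D where "D = mat n n (\<lambda>(i, l). if i = l then (?s i)\<^sup>2 else 0)"
  have P: "P \<in> carrier_mat n n" and D: "D \<in> carrier_mat n n" by (auto simp: P_def D_def)
  have PP: "P\<^sup>T * P = 1\<^sub>m n"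
  proof (rule eq_matI)
    fix i l assume "i < dim_row (1\<^sub>m n :: real mat)" "l < dim_col (1\<^sub>m n :: real mat)"
    then have il: "i < n" "l < n" by auto
    then have "(P\<^sup>T * P) $$ (i, l) = dot n (v i) (v l)"
      unfolding dot_def by (simp add: scalar_prod_def P_def lessThan_atLeast0)
    then show "(P\<^sup>T * P) $$ (i, l) = 1\<^sub>m n $$ (i, l)" using il by (simp add: orth)
  qed (use P in auto)
  then have PP': "P * P\<^sup>T = 1\<^sub>m n" using mat_mult_left_right_inverse[of "P\<^sup>T" n P] P by simp
  have XP: "(X * P) $$ (a, i) = mapply n (entries X) (v i) a" if "a < m" "i < n" for a i
  proof -
    have "(X * P) $$ (a, i) = (\<Sum>b<n. X $$ (a, b) * P $$ (b, i))"
      using that X P by (simp add: scalar_prod_def lessThan_atLeast0)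
    then show ?thesis using that by (simp add: mapply_def P_def)
  qed
  have "(X * P)\<^sup>T * (X * P) = D"
  proof (rule eq_matI)
    fix i l assume "i < dim_row D" "l < dim_col D"
    then have il: "i < n" "l < n" by (auto simp: D_def)
    have "((X * P)\<^sup>T * (X * P)) $$ (i, l) = (\<Sum>a<m. (X * P) $$ (a, i) * (X * P) $$ (a, l))"
      using il X P by (simp add: scalar_prod_def lessThan_atLeast0)
    also have "\<dots> = dot m (mapply n (entries X) (v i)) (mapply n (entries X) (v l))"
      unfolding dot_def using il XP by (intro sum.cong) auto
    also have "\<dots> = D $$ (i, l)"
      using il images[of i l] by (auto simp: D_def dot_self)
    finally show "((X * P)\<^sup>T * (X * P)) $$ (i, l) = D $$ (i, l)" .
  qed (use X P in \<open>auto simp: D_def\<close>)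
  then have "P\<^sup>T * (X\<^sup>T * X) * P = D"
    using X P by (simp add: transpose_mult[OF X P] assoc_mult_mat[of _ n n _ n _ n]
        assoc_mult_mat[of _ n m _ n _ n] assoc_mult_mat[of _ n n _ m _ n])
  then have "similar_mat_wit D (X\<^sup>T * X) (P\<^sup>T) P"
    using X P D PP PP' by (intro similar_mat_witI[where n = n]) auto
  then have "char_poly (X\<^sup>T * X) = char_poly D"
    by (metis char_poly_similar similar_mat_def)
  also have "\<dots> = (\<Prod>a\<leftarrow>diag_mat D. [:- a, 1:])"
    using D by (intro char_poly_upper_triangular) (auto simp: D_def)
  finally have "proots (char_poly (X\<^sup>T * X)) = mset (diag_mat D)"
    by (simp add: proots_linear_factors)
  moreover have "map sqrt (diag_mat D) = map ?s [0..<n]"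
    using D by (auto simp: diag_mat_def D_def)
  ultimately have "image_mset sqrt (proots (char_poly (X\<^sup>T * X))) = mset (rev (map ?s [0..<n]))"
    by (metis mset_map mset_rev)
  moreover have "sorted (rev (map ?s [0..<n]))"
    by (auto simp: sorted_iff_nth_mono rev_nth intro!: decreasing)
  ultimately show ?thesis
    unfolding singular_values_def by (simp add: sorted_sort_id del: mset_rev flip: rev_map)
qed

section \<open>The min-max principle\<close>

text \<open>Pythagoras' theorem, in the domain and in the image.\<close>

lemma nrm_image_singular_vectors:
  fixes c :: "nat \<Rightarrow> real"
  assumes orth: "\<And>i l. i < n \<Longrightarrow> l < n \<Longrightarrow> dot n (v i) (v l) = (if i = l then 1 else 0)"
    and images: "\<And>i l. i < n \<Longrightarrow> l < n \<Longrightarrow> i \<noteq> l \<Longrightarrow>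
      dot m (mapply n X (v i)) (mapply n X (v l)) = 0"
    and L: "L \<subseteq> {..<n}"
  defines "x \<equiv> \<lambda>a. \<Sum>l\<in>L. c l * v l a"
  shows "(nrm n x)\<^sup>2 = (\<Sum>l\<in>L. (c l)\<^sup>2)"
    and "(nrm m (mapply n X x))\<^sup>2 = (\<Sum>l\<in>L. (c l)\<^sup>2 * (nrm m (mapply n X (v l)))\<^sup>2)"
proof -
  have fin: "finite L" using L finite_subset by blast
  have "dot n x x = (\<Sum>l\<in>L. \<Sum>l'\<in>L. c l * (c l' * dot n (v l) (v l')))"
    unfolding x_def dot_sum_left dot_sum_right dot_scale_left dot_scale_right
    by (simp add: mult_ac dot_commute)
  also have "\<dots> = (\<Sum>l\<in>L. \<Sum>l'\<in>L. if l = l' then (c l)\<^sup>2 else 0)"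
    using L orth by (intro sum.cong refl) (auto simp: power2_eq_square subset_iff)
  finally show "(nrm n x)\<^sup>2 = (\<Sum>l\<in>L. (c l)\<^sup>2)"
    using fin by (simp add: dot_self)
  have X: "mapply n X x = (\<lambda>a. \<Sum>l\<in>L. c l * mapply n X (v l) a)"
    unfolding x_def mapply_sum mapply_scale ..
  have "dot m (mapply n X x) (mapply n X x)
      = (\<Sum>l\<in>L. \<Sum>l'\<in>L. c l * (c l' * dot m (mapply n X (v l)) (mapply n X (v l'))))"
    unfolding X dot_sum_left dot_sum_right dot_scale_left dot_scale_right
    by (simp add: mult_ac dot_commute)
  also have "\<dots> = (\<Sum>l\<in>L. \<Sum>l'\<in>L. if l = l' then (c l)\<^sup>2 * (nrm m (mapply n X (v l)))\<^sup>2 else 0)"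
    using L images by (intro sum.cong refl) (auto simp: dot_self power2_eq_square subset_iff)
  finally show "(nrm m (mapply n X x))\<^sup>2 = (\<Sum>l\<in>L. (c l)\<^sup>2 * (nrm m (mapply n X (v l)))\<^sup>2)"
    using fin by (simp add: dot_self)
qed

text \<open>The third clause is the maximality from the construction of the basis; it bounds \<open>\<bar>X y\<bar>\<close> for all \<open>y\<close>
  that are orthogonal to the first \<open>i\<close> vectors.\<close>

definition right_singular_basis :: "nat \<Rightarrow> nat \<Rightarrow> real mat \<Rightarrow> (nat \<Rightarrow> nat \<Rightarrow> real) \<Rightarrow> bool" where
  "right_singular_basis m n X v \<longleftrightarrow>
     (\<forall>i<n. \<forall>l<n. dot n (v i) (v l) = (if i = l then 1 else 0)) \<and>
     (\<forall>i<n. \<forall>l<n. i \<noteq> l \<longrightarrow>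
       dot m (mapply n (entries X) (v i)) (mapply n (entries X) (v l)) = 0) \<and>
     (\<forall>i<n. \<forall>y. (\<forall>l<i. dot n (v l) y = 0) \<longrightarrow>
       nrm m (mapply n (entries X) y) \<le> singular_values X ! i * nrm n y) \<and>
     (\<forall>i<n. nrm m (mapply n (entries X) (v i)) = singular_values X ! i) \<and>
     (\<forall>l<n. \<forall>i\<le>l. singular_values X ! l \<le> singular_values X ! i)"

lemma right_singular_basis_exists:
  assumes X: "X \<in> carrier_mat m n"
  shows "\<exists>v. right_singular_basis m n X v"
proof -
  obtain v where orth: "\<And>i l. i < n \<Longrightarrow> l < n \<Longrightarrow> dot n (v i) (v l) = (if i = l then 1 else 0)"
    and images: "\<And>i l. i < n \<Longrightarrow> l < n \<Longrightarrow> i \<noteq> l \<Longrightarrow>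
       dot m (mapply n (entries X) (v i)) (mapply n (entries X) (v l)) = 0"
    and max: "\<And>i y. i < n \<Longrightarrow> \<forall>l<i. dot n (v l) y = 0 \<Longrightarrow>
       nrm m (mapply n (entries X) y) \<le> nrm m (mapply n (entries X) (v i)) * nrm n y"
    using singular_vectors_exist[of n m "entries X"] by blast
  have decreasing: "nrm m (mapply n (entries X) (v l)) \<le> nrm m (mapply n (entries X) (v i))"
    if "i \<le> l" "l < n" for i l
  proof -
    have "(nrm n (v l))\<^sup>2 = 1" using that orth[of l l] by (simp add: dot_self)
    then have "nrm n (v l) = 1" by (simp add: power2_eq_1_iff) (metis nrm_nonneg not_one_le_zero neg_0_le_iff_le)
    then show ?thesis using that max[of i "v l"] orth by auto
  qed
  have sv: "singular_values X = map (\<lambda>i. nrm m (mapply n (entries X) (v i))) [0..<n]"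
    using singular_values_eq[OF X orth images decreasing] .
  show ?thesis
    by (rule exI[of _ v], unfold right_singular_basis_def) (use orth images max decreasing sv in auto)
qed

lemma singular_value_nonneg:
  assumes "X \<in> carrier_mat m n" "j < n"
  shows "0 \<le> singular_values X ! j"
proof -
  obtain v where "right_singular_basis m n X v" using right_singular_basis_exists[OF assms(1)] by blast
  then have "nrm m (mapply n (entries X) (v j)) = singular_values X ! j"
    using assms(2) by (simp add: right_singular_basis_def)
  then show ?thesis by (metis nrm_nonneg)
qed

text \<open>The \<open>j + 1\<close> vectors \<open>w 0, \<dots>, w j\<close> span a space that contains a nonzero vector orthogonal to the
  first \<open>j\<close> singular vectors, and on such vectors \<open>X\<close> stretches by at most the singular value with
  index \<open>j\<close>.\<close>

lemma singular_value_ge: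
  assumes X: "X \<in> carrier_mat m n" and j: "j < n"
    and expand: "\<And>c. \<exists>l\<le>j. c l \<noteq> 0 \<Longrightarrow> \<forall>l>j. c l = 0 \<Longrightarrow>
      0 < nrm n (\<lambda>a. \<Sum>l\<le>j. c l * w l a) \<and>
      g * nrm n (\<lambda>a. \<Sum>l\<le>j. c l * w l a) \<le> nrm m (mapply n (entries X) (\<lambda>a. \<Sum>l\<le>j. c l * w l a))"
  shows "g \<le> singular_values X ! j"
proof -
  obtain v where v: "right_singular_basis m n X v" using right_singular_basis_exists[OF X] by blast
  have max: "nrm m (mapply n (entries X) y) \<le> singular_values X ! j * nrm n y"
    if "\<forall>l<j. dot n (v l) y = 0" for y
    using v j that unfolding right_singular_basis_def by blast
  obtain c where c: "\<forall>l\<ge>Suc j. c l = 0" "\<exists>l<Suc j. c l \<noteq> 0"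
    "\<forall>i<j. dot (Suc j) (\<lambda>l. dot n (v i) (w l)) c = 0"
    using homogeneous_solution[of j "Suc j" "\<lambda>i l. dot n (v i) (w l)"] by auto
  define x where "x = (\<lambda>a. \<Sum>l\<le>j. c l * w l a)"
  have "dot n (v i) x = dot (Suc j) (\<lambda>l. dot n (v i) (w l)) c" for i
    unfolding x_def dot_sum_right dot_scale_right
    by (simp add: dot_def[of "Suc j"] lessThan_Suc_atMost mult.commute)
  then have "nrm m (mapply n (entries X) x) \<le> singular_values X ! j * nrm n x"
    using c j by (intro max) auto
  moreover have "0 < nrm n x" "g * nrm n x \<le> nrm m (mapply n (entries X) x)"
    unfolding x_def using expand[of c] c by (auto simp: less_Suc_eq_le Suc_le_eq)
  ultimately have "g * nrm n x \<le> singular_values X ! j * nrm n x" by linarith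
  then show ?thesis using \<open>0 < nrm n x\<close> by simp
qed

text \<open>Among the combinations of the first \<open>j + 1\<close> singular vectors, which \<open>X\<close> stretches by at least the
  singular value with index \<open>j\<close>, there is a nonzero one that satisfies \<open>j\<close> given orthogonality
  conditions.\<close>

lemma singular_value_le:
  assumes X: "X \<in> carrier_mat m n" and j: "j < n"
    and bound: "\<And>x. \<forall>l<j. dot n (w l) x = 0 \<Longrightarrow> nrm m (mapply n (entries X) x) \<le> g * nrm n x"
  shows "singular_values X ! j \<le> g"
proof -
  obtain v where v: "right_singular_basis m n X v" using right_singular_basis_exists[OF X] by blast
  have orth: "dot n (v i) (v l) = (if i = l then 1 else 0)" if "i < n" "l < n" for i l
    using v that by (simp add: right_singular_basis_def)
  have images: "dot m (mapply n (entries X) (v i)) (mapply n (entries X) (v l)) = 0"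
    if "i < n" "l < n" "i \<noteq> l" for i l
    using v that by (simp add: right_singular_basis_def)
  have sv: "nrm m (mapply n (entries X) (v i)) = singular_values X ! i" if "i < n" for i
    using v that by (simp add: right_singular_basis_def)
  have dec: "singular_values X ! l \<le> singular_values X ! i" if "i \<le> l" "l < n" for i l
    using v that by (simp add: right_singular_basis_def)
  obtain c where c: "\<exists>l<Suc j. c l \<noteq> 0"
    "\<forall>i<j. dot (Suc j) (\<lambda>l. dot n (w i) (v l)) c = 0"
    using homogeneous_solution[of j "Suc j" "\<lambda>i l. dot n (w i) (v l)"] by (metis lessI)
  define x where "x = (\<lambda>a. \<Sum>l\<le>j. c l * v l a)"
  note pyth = nrm_image_singular_vectors[OF orth images, of "{..j}" c, folded x_def]
  have J: "{..j} \<subseteq> {..<n}" using j by auto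
  have nonneg: "0 \<le> singular_values X ! j" using singular_value_nonneg[OF X j] .
  have "(singular_values X ! j * nrm n x)\<^sup>2 = (\<Sum>l\<le>j. (c l)\<^sup>2 * (singular_values X ! j)\<^sup>2)"
    using pyth(1) J by (simp add: power_mult_distrib sum_distrib_left mult.commute)
  also have "\<dots> \<le> (\<Sum>l\<le>j. (c l)\<^sup>2 * (singular_values X ! l)\<^sup>2)"
    using nonneg dec j by (intro sum_mono mult_left_mono power_mono) auto
  also have "\<dots> = (nrm m (mapply n (entries X) x))\<^sup>2"
    using pyth(2) J sv j by simp
  finally have "singular_values X ! j * nrm n x \<le> nrm m (mapply n (entries X) x)"
    by (rule power2_le_imp_le) simp
  also have "\<dots> \<le> g * nrm n x"
  proof (rule bound)
    have "dot n (w i) x = dot (Suc j) (\<lambda>l. dot n (w i) (v l)) c" for i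
      unfolding x_def dot_sum_right dot_scale_right
      by (simp add: dot_def[of "Suc j"] lessThan_Suc_atMost mult.commute)
    then show "\<forall>l<j. dot n (w l) x = 0" using c by simp
  qed
  finally have "singular_values X ! j * nrm n x \<le> g * nrm n x" .
  moreover have "0 < nrm n x"
  proof -
    obtain l where l: "l \<le> j" "c l \<noteq> 0" using c(1) by (auto simp: less_Suc_eq_le)
    then have "0 < (c l)\<^sup>2" by simp
    also have "\<dots> \<le> (\<Sum>l\<le>j. (c l)\<^sup>2)" using l by (intro member_le_sum) auto
    finally have "0 < (nrm n x)\<^sup>2" using pyth(1) J by simp
    then show ?thesis by (metis nrm_nonneg less_eq_real_def power_zero_numeral less_irrefl)
  qed
  ultimately show ?thesis by simp
qed

section \<open>Singular values from an approximate decomposition\<close>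

lemma nrm_mono: "(\<And>i. i < n \<Longrightarrow> \<bar>x i\<bar> \<le> \<bar>y i\<bar>) \<Longrightarrow> nrm n x \<le> nrm n y"
  by (auto simp: nrm_def L2_set_def abs_le_square_iff intro!: sum_mono)

text \<open>Both bounds test the min-max principle with columns of \<open>V\<close>. For the lower bound, let \<open>x = V c\<close> with
  \<open>c\<close> supported on the first \<open>j + 1\<close> indices, and let \<open>z\<close> be the restriction of \<open>V\<^sup>T x\<close> to these
  indices. Then \<open>\<bar>x\<bar>\<^sup>2 = c \<bullet> z \<le> \<bar>c\<bar> \<bar>z\<bar>\<close> and \<open>\<bar>c\<bar> \<le> \<bar>x\<bar>\<close> give \<open>\<bar>x\<bar> \<le> \<bar>z\<bar>\<close>, so
  \<open>s j \<bar>x\<bar> \<le> \<bar>S V\<^sup>T x\<bar> \<le> \<bar>U S V\<^sup>T x\<bar>\<close>. For the upper bound, let \<open>x\<close> be orthogonal to the first \<open>j\<close>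
  columns; then \<open>\<bar>S V\<^sup>T x\<bar> \<le> s j \<bar>V\<^sup>T x\<bar>\<close>, and the transpose \<open>V\<^sup>T\<close> obeys the same norm bound as \<open>V\<close>.\<close>

lemma approximate_svd_singular_values:
  fixes s :: "nat \<Rightarrow> real"
  assumes X: "X \<in> carrier_mat m n" and j: "j < r" and d: "0 \<le> d"
    and U: "\<And>c. nrm r c \<le> nrm m (mapply r U c)" "\<And>c. nrm m (mapply r U c) \<le> (1 + d) * nrm r c"
    and V: "\<And>c. nrm r c \<le> nrm n (mapply r V c)" "\<And>c. nrm n (mapply r V c) \<le> (1 + d) * nrm r c"
    and s: "\<And>l. l < r \<Longrightarrow> 0 \<le> s l" "\<And>l l'. l \<le> l' \<Longrightarrow> l' < r \<Longrightarrow> s l' \<le> s l"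
    and err: "\<And>x. nrm m (\<lambda>a. mapply n (entries X) x a
        - mapply r U (\<lambda>l. s l * mapply n (\<lambda>l b. V b l) x l) a) \<le> d * nrm n x"
  shows "s j - d \<le> singular_values X ! j" and "singular_values X ! j \<le> (1 + d)\<^sup>2 * s j + d"
    and "j < n"
proof -
  define Vt where "Vt = mapply n (\<lambda>l b. V b l)"
  have adj: "dot n (mapply r V c) x = dot r c (Vt x)" for c x
    unfolding Vt_def by (rule dot_mapply)
  \<comment> \<open>The map \<open>V\<close> is injective, so it cannot have more columns than rows.\<close>
  have "r \<le> n"
  proof (rule ccontr)
    assume "\<not> r \<le> n"
    then obtain c where c: "\<exists>l<r. c l \<noteq> 0" "\<forall>a<n. dot r (V a) c = 0"
      using homogeneous_solution[of n r V] by (metis not_le)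
    then have "nrm n (mapply r V c) = 0" by (simp add: nrm_eq_0_iff mapply_def dot_def)
    then have "nrm r c = 0" using V(1)[of c] nrm_nonneg[of r c] by simp
    then show False using c(1) by (auto simp: nrm_eq_0_iff)
  qed
  then show jn: "j < n" using j by simp
  show "s j - d \<le> singular_values X ! j"
  proof (rule singular_value_ge[OF X jn, where w = "\<lambda>l a. V a l"])
    fix c :: "nat \<Rightarrow> real" assume c: "\<exists>l\<le>j. c l \<noteq> 0" "\<forall>l>j. c l = 0"
    define x where "x = mapply r V c"
    have x: "(\<lambda>a. \<Sum>l\<le>j. c l * V a l) = x"
      unfolding x_def mapply_def using c(2) j
      by (intro ext sum.mono_neutral_cong_left) (auto simp: not_le)
    have cpos: "0 < nrm r c"
      using c(1) j nrm_eq_0_iff[of r c] nrm_nonneg[of r c] by (auto simp: less_eq_real_def dest: le_less_trans)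
    then have xpos: "0 < nrm n x" using V(1)[of c] by (simp add: x_def)
    define y where "y = Vt x"
    define z where "z l = (if l \<le> j then y l else 0)" for l
    have "nrm n x * nrm r c \<le> (nrm n x)\<^sup>2"
      using V(1)[of c] xpos by (simp add: power2_eq_square x_def)
    also have "\<dots> = dot r c y"
      unfolding dot_self[symmetric] y_def adj[symmetric] x_def ..
    also have "\<dots> = dot r c z"
      unfolding dot_def using c(2) by (intro sum.cong) (auto simp: z_def)
    also have "\<dots> \<le> nrm r c * nrm r z" by (rule dot_le_nrm)
    finally have xz: "nrm n x \<le> nrm r z" using cpos by (simp add: mult.commute)
    have "s j * nrm n x \<le> s j * nrm r z"
      using xz s(1)[OF j] by (rule mult_left_mono)
    also have "\<dots> = nrm r (\<lambda>l. s j * z l)" using s(1)[OF j] by (simp add: nrm_scale)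
    also have "\<dots> \<le> nrm r (\<lambda>l. s l * y l)"
      using j s by (intro nrm_mono) (auto simp: z_def abs_mult intro!: mult_right_mono)
    also have "\<dots> \<le> nrm m (mapply r U (\<lambda>l. s l * y l))" by (rule U(1))
    also have "\<dots> \<le> nrm m (mapply n (entries X) x) + d * nrm n x"
    proof -
      have "nrm m (mapply r U (\<lambda>l. s l * y l)) =
          nrm m (\<lambda>a. mapply n (entries X) x a
            + (-1) * (mapply n (entries X) x a - mapply r U (\<lambda>l. s l * y l) a))" by simp
      also have "\<dots> \<le> nrm m (mapply n (entries X) x)
          + nrm m (\<lambda>a. (-1) * (mapply n (entries X) x a - mapply r U (\<lambda>l. s l * y l) a))"
        by (rule nrm_triangle)
      also have "\<dots> \<le> nrm m (mapply n (entries X) x) + d * nrm n x"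
        unfolding nrm_scale using err[of x] by (simp add: y_def Vt_def)
      finally show ?thesis .
    qed
    finally show "0 < nrm n (\<lambda>a. \<Sum>l\<le>j. c l * V a l) \<and>
        (s j - d) * nrm n (\<lambda>a. \<Sum>l\<le>j. c l * V a l)
        \<le> nrm m (mapply n (entries X) (\<lambda>a. \<Sum>l\<le>j. c l * V a l))"
      unfolding x using xpos by (simp add: algebra_simps)
  qed
  show "singular_values X ! j \<le> (1 + d)\<^sup>2 * s j + d"
  proof (rule singular_value_le[OF X jn, where w = "\<lambda>l a. V a l"])
    fix x assume x: "\<forall>l<j. dot n (\<lambda>a. V a l) x = 0"
    define y where "y = Vt x"
    have y0: "y l = 0" if "l < j" for l
      using x that by (simp add: y_def Vt_def mapply_def dot_def)
    have "(nrm r y)\<^sup>2 = dot n (mapply r V y) x" by (simp add: adj dot_self y_def)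
    also have "\<dots> \<le> nrm n (mapply r V y) * nrm n x" by (rule dot_le_nrm)
    also have "\<dots> \<le> ((1 + d) * nrm r y) * nrm n x" by (intro mult_right_mono V(2)) simp
    finally have "nrm r y * nrm r y \<le> ((1 + d) * nrm n x) * nrm r y"
      by (simp add: power2_eq_square mult_ac)
    moreover have "0 \<le> (1 + d) * nrm n x" using d by simp
    ultimately have y: "nrm r y \<le> (1 + d) * nrm n x"
      by (metis mult_right_le_imp_le nrm_nonneg less_eq_real_def)
    have "nrm m (mapply n (entries X) x) =
        nrm m (\<lambda>a. mapply r U (\<lambda>l. s l * y l) a
          + (mapply n (entries X) x a - mapply r U (\<lambda>l. s l * y l) a))" by simp
    also have "\<dots> \<le> nrm m (mapply r U (\<lambda>l. s l * y l))
        + nrm m (\<lambda>a. mapply n (entries X) x a - mapply r U (\<lambda>l. s l * y l) a)"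
      by (rule nrm_triangle)
    also have "\<dots> \<le> (1 + d) * nrm r (\<lambda>l. s l * y l) + d * nrm n x"
      using U(2) err[of x] by (intro add_mono) (auto simp: y_def Vt_def)
    finally have split: "nrm m (mapply n (entries X) x)
        \<le> (1 + d) * nrm r (\<lambda>l. s l * y l) + d * nrm n x" .
    have "nrm r (\<lambda>l. s l * y l) \<le> nrm r (\<lambda>l. s j * y l)"
    proof (rule nrm_mono)
      show "\<bar>s l * y l\<bar> \<le> \<bar>s j * y l\<bar>" if "l < r" for l
        using that j s y0 by (cases "l < j") (auto simp: abs_mult intro!: mult_right_mono)
    qed
    also have "nrm r (\<lambda>l. s j * y l) \<le> s j * ((1 + d) * nrm n x)"
      using y s(1)[OF j] by (simp add: nrm_scale mult_left_mono)
    finally have "(1 + d) * nrm r (\<lambda>l. s l * y l) \<le> (1 + d) * (s j * ((1 + d) * nrm n x))"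
      using d by (intro mult_left_mono) auto
    with split show "nrm m (mapply n (entries X) x) \<le> ((1 + d)\<^sup>2 * s j + d) * nrm n x"
      by (simp add: algebra_simps power2_eq_square)
  qed
qed

section \<open>Substituting a real number for the infinitesimal unit\<close>

text \<open>A crude bound of the operator norm, which serves to absorb everything of order \<open>t\<^sup>2\<close>.\<close>

lemma nrm_mapply_le: "nrm m (mapply r Z c) \<le> (\<Sum>i<m. \<Sum>l<r. \<bar>Z i l\<bar>) * nrm r c"
proof -
  have member: "\<bar>c l\<bar> \<le> nrm r c" if "l < r" for l
  proof (rule power2_le_imp_le)
    have "c l * c l \<le> dot r c c"
      unfolding dot_def using that by (intro member_le_sum) auto
    then show "\<bar>c l\<bar>\<^sup>2 \<le> (nrm r c)\<^sup>2" by (simp add: dot_self power2_eq_square)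
  qed simp
  have "nrm m (mapply r Z c) \<le> (\<Sum>i<m. \<bar>mapply r Z c i\<bar>)"
    unfolding nrm_def by (rule L2_set_le_sum_abs)
  also have "\<dots> \<le> (\<Sum>i<m. \<Sum>l<r. \<bar>Z i l\<bar> * nrm r c)"
  proof (rule sum_mono)
    fix i
    have "\<bar>mapply r Z c i\<bar> \<le> (\<Sum>l<r. \<bar>Z i l * c l\<bar>)" unfolding mapply_def by (rule sum_abs)
    also have "\<dots> \<le> (\<Sum>l<r. \<bar>Z i l\<bar> * nrm r c)"
      using member by (intro sum_mono) (auto simp: abs_mult intro: mult_left_mono)
    finally show "\<bar>mapply r Z c i\<bar> \<le> (\<Sum>l<r. \<bar>Z i l\<bar> * nrm r c)" .
  qed
  finally show ?thesis by (simp add: sum_distrib_right)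
qed

lemma dot_mapply_mapply:
  "dot m (mapply r Y c) (mapply r Z c)
    = (\<Sum>l<r. \<Sum>l'<r. c l * c l' * dot m (\<lambda>i. Y i l) (\<lambda>i. Z i l'))"
proof -
  have "mapply r W c = (\<lambda>i. \<Sum>l<r. c l * W i l)" for W by (simp add: mapply_def mult.commute)
  then have "dot m (mapply r Y c) (mapply r Z c)
      = dot m (\<lambda>i. \<Sum>l<r. c l * Y i l) (\<lambda>i. \<Sum>l'<r. c l' * Z i l')" by simp
  also have "\<dots> = (\<Sum>l<r. c l * (\<Sum>l'<r. c l' * dot m (\<lambda>i. Y i l) (\<lambda>i. Z i l')))"
    by (simp only: dot_sum_left dot_scale_left dot_sum_right dot_scale_right)
  finally show ?thesis by (simp add: sum_distrib_left mult.assoc)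
qed

text \<open>The hypotheses are the standard and the infinitesimal part of \<open>Y\<^sup>T Y = 1\<close>. By the second one the
  term of order \<open>t\<close> in \<open>\<bar>(Ys + t Yi) c\<bar>\<^sup>2\<close> vanishes, which leaves \<open>\<bar>c\<bar>\<^sup>2 + t\<^sup>2 \<bar>Yi c\<bar>\<^sup>2\<close>. In
  particular the lower bound holds without an error term.\<close>

lemma orthonormal_to_first_order:
  assumes orth: "\<And>l l'. l < r \<Longrightarrow> l' < r \<Longrightarrow>
      dot m (\<lambda>i. Ys i l) (\<lambda>i. Ys i l') = (if l = l' then 1 else 0)"
    and skew: "\<And>l l'. l < r \<Longrightarrow> l' < r \<Longrightarrow>
      dot m (\<lambda>i. Ys i l) (\<lambda>i. Yi i l') + dot m (\<lambda>i. Yi i l) (\<lambda>i. Ys i l') = 0"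
  shows "\<exists>K\<ge>0. \<forall>t c. nrm r c \<le> nrm m (mapply r (\<lambda>i l. Ys i l + t * Yi i l) c) \<and>
      nrm m (mapply r (\<lambda>i l. Ys i l + t * Yi i l) c) \<le> (1 + K * t\<^sup>2) * nrm r c"
proof -
  define K where "K = (\<Sum>i<m. \<Sum>l<r. \<bar>Yi i l\<bar>)"
  have K: "0 \<le> K" unfolding K_def by (intro sum_nonneg) auto
  have "nrm r c \<le> nrm m (mapply r (\<lambda>i l. Ys i l + t * Yi i l) c) \<and>
      nrm m (mapply r (\<lambda>i l. Ys i l + t * Yi i l) c) \<le> (1 + K\<^sup>2 * t\<^sup>2) * nrm r c" for t c
  proof -
    let ?Y = "mapply r (\<lambda>i l. Ys i l + t * Yi i l) c"
    have "dot m (mapply r Ys c) (mapply r Ys c) = (\<Sum>l<r. \<Sum>l'<r. if l = l' then c l * c l else 0)"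
      unfolding dot_mapply_mapply using orth by (intro sum.cong refl) auto
    then have iso: "dot m (mapply r Ys c) (mapply r Ys c) = (nrm r c)\<^sup>2"
      by (simp add: dot_self[of r, symmetric] dot_def[of r])
    have "2 * dot m (mapply r Ys c) (mapply r Yi c)
        = dot m (mapply r Ys c) (mapply r Yi c) + dot m (mapply r Yi c) (mapply r Ys c)"
      by (simp add: dot_commute)
    also have "\<dots> = (\<Sum>l<r. \<Sum>l'<r. c l * c l' * (dot m (\<lambda>i. Ys i l) (\<lambda>i. Yi i l')
        + dot m (\<lambda>i. Yi i l) (\<lambda>i. Ys i l')))"
      unfolding dot_mapply_mapply by (simp add: sum.distrib algebra_simps)
    also have "\<dots> = 0" using skew by simp
    finally have cross: "dot m (mapply r Ys c) (mapply r Yi c) = 0" by simp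
    have "?Y = (\<lambda>i. mapply r Ys c i + t * mapply r Yi c i)"
      by (simp add: mapply_def algebra_simps sum.distrib sum_distrib_left)
    then have "dot m ?Y ?Y = dot m (mapply r Ys c) (mapply r Ys c)
        + 2 * t * dot m (mapply r Ys c) (mapply r Yi c) + t\<^sup>2 * dot m (mapply r Yi c) (mapply r Yi c)"
      by (simp add: dot_linear dot_commute[of m "mapply r Yi c" "mapply r Ys c"]
          power2_eq_square algebra_simps)
    then have Y: "(nrm m ?Y)\<^sup>2 = (nrm r c)\<^sup>2 + t\<^sup>2 * (nrm m (mapply r Yi c))\<^sup>2"
      unfolding iso cross by (simp add: dot_self)
    have "(nrm m (mapply r Yi c))\<^sup>2 \<le> (K * nrm r c)\<^sup>2"
      unfolding K_def by (intro power_mono nrm_mapply_le) simp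
    then have "t\<^sup>2 * (nrm m (mapply r Yi c))\<^sup>2 \<le> t\<^sup>2 * (K * nrm r c)\<^sup>2"
      by (rule mult_left_mono) simp
    moreover have "0 \<le> (K\<^sup>2 * t\<^sup>2)\<^sup>2 * (nrm r c)\<^sup>2" "0 \<le> K\<^sup>2 * t\<^sup>2 * (nrm r c)\<^sup>2" by auto
    moreover have "((1 + K\<^sup>2 * t\<^sup>2) * nrm r c)\<^sup>2
        = (nrm r c)\<^sup>2 + 2 * (K\<^sup>2 * t\<^sup>2 * (nrm r c)\<^sup>2) + (K\<^sup>2 * t\<^sup>2)\<^sup>2 * (nrm r c)\<^sup>2"
      by (simp add: power2_eq_square algebra_simps)
    moreover have "t\<^sup>2 * (K * nrm r c)\<^sup>2 = K\<^sup>2 * t\<^sup>2 * (nrm r c)\<^sup>2"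
      by (simp add: power_mult_distrib)
    ultimately have "(nrm m ?Y)\<^sup>2 \<le> ((1 + K\<^sup>2 * t\<^sup>2) * nrm r c)\<^sup>2"
      unfolding Y by linarith
    moreover have "(nrm r c)\<^sup>2 \<le> (nrm m ?Y)\<^sup>2" unfolding Y by simp
    ultimately show ?thesis by (auto intro: power2_le_imp_le)
  qed
  then show ?thesis by (intro exI[of _ "K\<^sup>2"]) simp
qed

lemma triple_product_expansion:
  fixes a a' b b' c c' t :: real
  shows "(a + t * a') * (b + t * b') * (c + t * c')
    = a * b * c + t * (a' * b * c + a * b' * c + a * b * c')
      + t\<^sup>2 * (a' * b' * c + a' * b * c' + a * b' * c' + t * (a' * b' * c'))"
  by (simp add: algebra_simps power2_eq_square)

text \<open>The hypotheses are the standard and the infinitesimal part of \<open>X = U S V\<^sup>T\<close>; they cancel the terms of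
  order \<open>1\<close> and \<open>t\<close> in the expansion of \<open>U(t) S(t) V(t)\<^sup>T\<close>.\<close>

lemma factorisation_to_first_order:
  fixes Us Ui Vs Vi :: "nat \<Rightarrow> nat \<Rightarrow> real"
  assumes Xs: "\<And>a b. a < m \<Longrightarrow> b < n \<Longrightarrow> Xs a b = (\<Sum>l<r. Us a l * ss l * Vs b l)"
    and Xi: "\<And>a b. a < m \<Longrightarrow> b < n \<Longrightarrow> Xi a b = (\<Sum>l<r.
      Ui a l * ss l * Vs b l + Us a l * si l * Vs b l + Us a l * ss l * Vi b l)"
  shows "\<exists>K\<ge>0. \<forall>t\<in>{0..1}. \<forall>x.
      nrm m (\<lambda>a. mapply n (\<lambda>a b. Xs a b + t * Xi a b) x a
        - mapply r (\<lambda>a l. Us a l + t * Ui a l)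
            (\<lambda>l. (ss l + t * si l) * mapply n (\<lambda>l b. Vs b l + t * Vi b l) x l) a)
      \<le> K * t\<^sup>2 * nrm n x"
proof -
  \<comment> \<open>The difference of the two matrices is \<open>t\<^sup>2 R\<close>, and \<open>Q\<close> bounds \<open>R\<close> uniformly for \<open>t\<close> in the unit interval.\<close>
  define R where "R t a b = (\<Sum>l<r. Ui a l * si l * Vs b l + Ui a l * ss l * Vi b l
      + Us a l * si l * Vi b l + t * (Ui a l * si l * Vi b l))" for t a b
  define Q where "Q a b = (\<Sum>l<r. \<bar>Ui a l * si l * Vs b l\<bar> + \<bar>Ui a l * ss l * Vi b l\<bar>
      + \<bar>Us a l * si l * Vi b l\<bar> + \<bar>Ui a l * si l * Vi b l\<bar>)" for a b
  have R: "\<bar>R t a b\<bar> \<le> Q a b" if "t \<in> {0..1}" for t a b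
  proof -
    have "\<bar>t * z\<bar> \<le> \<bar>z\<bar>" for z using that by (simp add: abs_mult mult_left_le_one_le)
    then have "\<bar>w + x + y + t * z\<bar> \<le> \<bar>w\<bar> + \<bar>x\<bar> + \<bar>y\<bar> + \<bar>z\<bar>" for w x y z
      by (smt (verit))
    then show ?thesis
      unfolding R_def Q_def by (intro order_trans[OF sum_abs] sum_mono)
  qed
  define K where "K = (\<Sum>a<m. \<Sum>b<n. Q a b)"
  have "nrm m (\<lambda>a. mapply n (\<lambda>a b. Xs a b + t * Xi a b) x a
        - mapply r (\<lambda>a l. Us a l + t * Ui a l)
            (\<lambda>l. (ss l + t * si l) * mapply n (\<lambda>l b. Vs b l + t * Vi b l) x l) a)
      \<le> K * t\<^sup>2 * nrm n x" if t: "t \<in> {0..1}" for t x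
  proof -
    have entry: "(\<Sum>l<r. (Us a l + t * Ui a l) * (ss l + t * si l) * (Vs b l + t * Vi b l))
        = Xs a b + t * Xi a b + t\<^sup>2 * R t a b" if "a < m" "b < n" for a b
    proof -
      have "(\<Sum>l<r. A l + t * B l + t\<^sup>2 * C l)
          = (\<Sum>l<r. A l) + t * (\<Sum>l<r. B l) + t\<^sup>2 * (\<Sum>l<r. C l)" for A B C
        by (simp add: sum.distrib sum_distrib_left)
      then show ?thesis
        unfolding triple_product_expansion Xs[OF that] Xi[OF that] R_def .
    qed
    have "mapply n (\<lambda>a b. Xs a b + t * Xi a b) x a
        - mapply r (\<lambda>a l. Us a l + t * Ui a l)
            (\<lambda>l. (ss l + t * si l) * mapply n (\<lambda>l b. Vs b l + t * Vi b l) x l) a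
        = mapply n (\<lambda>a b. - (t\<^sup>2 * R t a b)) x a" if "a < m" for a
    proof -
      have "mapply r (\<lambda>a l. Us a l + t * Ui a l)
            (\<lambda>l. (ss l + t * si l) * mapply n (\<lambda>l b. Vs b l + t * Vi b l) x l) a
          = (\<Sum>l<r. \<Sum>b<n. (Us a l + t * Ui a l) * (ss l + t * si l) * (Vs b l + t * Vi b l) * x b)"
        unfolding mapply_def sum_distrib_left by (simp only: mult.assoc)
      also have "\<dots> = (\<Sum>b<n. (\<Sum>l<r. (Us a l + t * Ui a l) * (ss l + t * si l) * (Vs b l + t * Vi b l)) * x b)"
        by (subst sum.swap) (simp only: sum_distrib_right)
      also have "\<dots> = (\<Sum>b<n. (Xs a b + t * Xi a b + t\<^sup>2 * R t a b) * x b)"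
        using entry that by (intro sum.cong) auto
      finally show ?thesis
        by (simp add: mapply_def algebra_simps sum.distrib sum_negf)
    qed
    then have "nrm m (\<lambda>a. mapply n (\<lambda>a b. Xs a b + t * Xi a b) x a
        - mapply r (\<lambda>a l. Us a l + t * Ui a l)
            (\<lambda>l. (ss l + t * si l) * mapply n (\<lambda>l b. Vs b l + t * Vi b l) x l) a)
      = nrm m (mapply n (\<lambda>a b. - (t\<^sup>2 * R t a b)) x)" by (rule nrm_cong)
    also have "\<dots> \<le> (\<Sum>a<m. \<Sum>b<n. \<bar>- (t\<^sup>2 * R t a b)\<bar>) * nrm n x" by (rule nrm_mapply_le)
    also have "\<dots> \<le> (\<Sum>a<m. \<Sum>b<n. t\<^sup>2 * Q a b) * nrm n x"
      using R[OF t] by (intro mult_right_mono sum_mono) (auto simp: abs_mult intro: mult_left_mono)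
    also have "\<dots> = K * t\<^sup>2 * nrm n x"
      unfolding K_def sum_distrib_left[symmetric] by (simp only: mult_ac)
    finally show ?thesis .
  qed
  moreover have "0 \<le> K" unfolding K_def Q_def by (intro sum_nonneg) auto
  ultimately show ?thesis by blast
qed

text \<open>The constant \<open>K\<close> is uniform in \<open>t\<close>, whereas the ordering of the numbers \<open>ss l + t * si l\<close> depends on
  \<open>t\<close>; it is therefore a premise inside the quantifier over \<open>t\<close>.\<close>

lemma singular_value_first_order:
  fixes Us Ui Vs Vi :: "nat \<Rightarrow> nat \<Rightarrow> real"
  assumes Xs: "Xs \<in> carrier_mat m n" "\<And>a b. a < m \<Longrightarrow> b < n \<Longrightarrow>
      Xs $$ (a, b) = (\<Sum>l<r. Us a l * ss l * Vs b l)"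
    and Xi: "Xi \<in> carrier_mat m n" "\<And>a b. a < m \<Longrightarrow> b < n \<Longrightarrow> Xi $$ (a, b) = (\<Sum>l<r.
      Ui a l * ss l * Vs b l + Us a l * si l * Vs b l + Us a l * ss l * Vi b l)"
    and U: "\<And>l l'. l < r \<Longrightarrow> l' < r \<Longrightarrow>
      dot m (\<lambda>i. Us i l) (\<lambda>i. Us i l') = (if l = l' then 1 else 0)"
      "\<And>l l'. l < r \<Longrightarrow> l' < r \<Longrightarrow>
      dot m (\<lambda>i. Us i l) (\<lambda>i. Ui i l') + dot m (\<lambda>i. Ui i l) (\<lambda>i. Us i l') = 0"
    and V: "\<And>l l'. l < r \<Longrightarrow> l' < r \<Longrightarrow>
      dot n (\<lambda>i. Vs i l) (\<lambda>i. Vs i l') = (if l = l' then 1 else 0)"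
      "\<And>l l'. l < r \<Longrightarrow> l' < r \<Longrightarrow>
      dot n (\<lambda>i. Vs i l) (\<lambda>i. Vi i l') + dot n (\<lambda>i. Vi i l) (\<lambda>i. Vs i l') = 0"
  shows "\<exists>K. \<forall>t\<in>{0..1}. (\<forall>l<r. 0 \<le> ss l + t * si l) \<longrightarrow>
      (\<forall>l'<r. \<forall>l\<le>l'. ss l' + t * si l' \<le> ss l + t * si l) \<longrightarrow>
      (\<forall>j<r. j < n \<and>
        \<bar>singular_values (Xs + t \<cdot>\<^sub>m Xi) ! j - (ss j + t * si j)\<bar> \<le> K * t\<^sup>2)"
proof -
  obtain KU where KU: "0 \<le> KU" "\<And>t c. nrm r c \<le> nrm m (mapply r (\<lambda>i l. Us i l + t * Ui i l) c)"
    "\<And>t c. nrm m (mapply r (\<lambda>i l. Us i l + t * Ui i l) c) \<le> (1 + KU * t\<^sup>2) * nrm r c"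
    using orthonormal_to_first_order[of r m Us Ui, OF U] by blast
  obtain KV where KV: "0 \<le> KV" "\<And>t c. nrm r c \<le> nrm n (mapply r (\<lambda>i l. Vs i l + t * Vi i l) c)"
    "\<And>t c. nrm n (mapply r (\<lambda>i l. Vs i l + t * Vi i l) c) \<le> (1 + KV * t\<^sup>2) * nrm r c"
    using orthonormal_to_first_order[of r n Vs Vi, OF V] by blast
  define E where "E t x = nrm m (\<lambda>a. mapply n (\<lambda>a b. entries Xs a b + t * entries Xi a b) x a
      - mapply r (\<lambda>a l. Us a l + t * Ui a l)
          (\<lambda>l. (ss l + t * si l) * mapply n (\<lambda>l b. Vs b l + t * Vi b l) x l) a)" for t x
  have "\<exists>K\<ge>0. \<forall>t\<in>{0..1}. \<forall>x. E t x \<le> K * t\<^sup>2 * nrm n x"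
    unfolding E_def by (rule factorisation_to_first_order[OF Xs(2) Xi(2)])
  then obtain KX where KX: "0 \<le> KX" "\<And>t x. t \<in> {0..1} \<Longrightarrow> E t x \<le> KX * t\<^sup>2 * nrm n x"
    by blast
  define k where "k = KU + KV + KX"
  have k: "0 \<le> k" "KU \<le> k" "KV \<le> k" "KX \<le> k" using KU(1) KV(1) KX(1) by (auto simp: k_def)
  define M where "M = (\<Sum>l<r. \<bar>ss l\<bar> + \<bar>si l\<bar>)"
  have M: "0 \<le> M" unfolding M_def by (intro sum_nonneg) auto
  have scale: "KU * t\<^sup>2 \<le> k * t\<^sup>2" "KV * t\<^sup>2 \<le> k * t\<^sup>2" "KX * t\<^sup>2 \<le> k * t\<^sup>2" for t :: real
    using k by (auto intro: mult_right_mono)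
  \<comment> \<open>With an error \<open>d \<le> k\<close> and \<open>s \<le> M\<close>, the gap between \<open>(1 + d)\<^sup>2 s + d\<close> and \<open>s\<close> is
      \<open>d ((2 + d) s + 1)\<close>, which explains the constant.\<close>
  show ?thesis
  proof (intro exI[of _ "k * ((2 + k) * M + 1)"] ballI allI impI)
    fix t :: real and j assume t: "t \<in> {0..1}" and j: "j < r"
      and all_pos: "\<forall>l<r. 0 \<le> ss l + t * si l"
      and all_dec: "\<forall>l'<r. \<forall>l\<le>l'. ss l' + t * si l' \<le> ss l + t * si l"
    have pos: "0 \<le> ss l + t * si l" if "l < r" for l using all_pos that by blast
    have dec: "ss l' + t * si l' \<le> ss l + t * si l" if "l \<le> l'" "l' < r" for l l'
      using all_dec that by blast
    define d where "d = k * t\<^sup>2"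
    let ?X = "Xs + t \<cdot>\<^sub>m Xi" and ?s = "ss j + t * si j"
    have X: "?X \<in> carrier_mat m n" using Xs Xi by simp
    have d: "0 \<le> d" "d \<le> k" using k t by (auto simp: d_def mult_left_le power_le_one)
    have up: "nrm m (mapply r (\<lambda>i l. Us i l + t * Ui i l) c) \<le> (1 + d) * nrm r c"
      "nrm n (mapply r (\<lambda>i l. Vs i l + t * Vi i l) c) \<le> (1 + d) * nrm r c" for c
      using scale[of t] unfolding d_def
      by (auto intro!: order_trans[OF KU(3)] order_trans[OF KV(3)] mult_right_mono)
    have err: "nrm m (\<lambda>a. mapply n (entries ?X) x a
        - mapply r (\<lambda>a l. Us a l + t * Ui a l)
            (\<lambda>l. (ss l + t * si l) * mapply n (\<lambda>l b. Vs b l + t * Vi b l) x l) a) \<le> d * nrm n x" for x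
    proof -
      have "mapply n (entries ?X) x a = mapply n (\<lambda>a b. entries Xs a b + t * entries Xi a b) x a"
        if "a < m" for a
        using that Xs Xi by (auto simp: mapply_def)
      then have "nrm m (\<lambda>a. mapply n (entries ?X) x a
        - mapply r (\<lambda>a l. Us a l + t * Ui a l)
            (\<lambda>l. (ss l + t * si l) * mapply n (\<lambda>l b. Vs b l + t * Vi b l) x l) a)
        = E t x"
        unfolding E_def by (intro nrm_cong) simp
      also have "\<dots> \<le> KX * t\<^sup>2 * nrm n x" using t by (intro KX(2)) simp
      also have "\<dots> \<le> d * nrm n x" unfolding d_def by (intro mult_right_mono scale) simp
      finally show ?thesis .
    qed
    note sv = approximate_svd_singular_values[OF X j d(1) KU(2) up(1) KV(2) up(2) pos dec err]
    have "\<bar>ss j\<bar> + \<bar>si j\<bar> \<le> M" unfolding M_def using j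
      by (intro member_le_sum[of j _ "\<lambda>l. \<bar>ss l\<bar> + \<bar>si l\<bar>"]) auto
    moreover have "\<bar>t * si j\<bar> \<le> \<bar>si j\<bar>" using t by (simp add: abs_mult mult_left_le_one_le)
    ultimately have sM: "0 \<le> ?s" "?s \<le> M" using pos[OF j] by linarith+
    have "(1 + d)\<^sup>2 * ?s + d - ?s = d * ((2 + d) * ?s + 1)"
      by (simp add: power2_eq_square algebra_simps)
    also have "\<dots> \<le> d * ((2 + k) * M + 1)"
      using d sM k by (intro mult_left_mono add_right_mono mult_mono) auto
    also have "\<dots> = k * ((2 + k) * M + 1) * t\<^sup>2" by (simp add: d_def)
    finally have upper: "(1 + d)\<^sup>2 * ?s + d - ?s \<le> k * ((2 + k) * M + 1) * t\<^sup>2" .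
    have "d * 1 \<le> d * ((2 + k) * M + 1)" using d k M by (intro mult_left_mono) auto
    then have lower: "d \<le> k * ((2 + k) * M + 1) * t\<^sup>2" by (simp add: d_def mult_ac)
    show "j < n \<and> \<bar>singular_values ?X ! j - ?s\<bar> \<le> k * ((2 + k) * M + 1) * t\<^sup>2"
      using sv upper lower by (auto simp: abs_le_iff)
  qed
qed

section \<open>The real p-norm is Lipschitz\<close>

text \<open>Convexity of \<open>x powr p\<close> on the closed half-line. At the boundary point \<open>0\<close> it reduces to
  \<open>w powr p \<le> w\<close> for \<open>w\<close> in the unit interval.\<close>

lemma powr_convex_combination:
  fixes p u v x y :: real
  assumes p: "1 \<le> p" and uv: "0 \<le> u" "0 \<le> v" "u + v = 1" and xy: "0 \<le> x" "0 \<le> y"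
  shows "(u * x + v * y) powr p \<le> u * x powr p + v * y powr p"
proof -
  have scaled: "(w * z) powr p \<le> w * z powr p" if "0 \<le> w" "w \<le> 1" "0 \<le> z" for w z
  proof (cases "w = 0")
    case False
    then have "w powr p \<le> w powr 1" using that p by (intro powr_mono') auto
    then show ?thesis using that False by (simp add: powr_mult mult_right_mono)
  qed simp
  consider "x = 0" | "y = 0" | "0 < x" "0 < y" using xy by linarith
  then show ?thesis
  proof cases
    case 1
    then show ?thesis using scaled[of v y] uv xy by simp
  next
    case 2
    then show ?thesis using scaled[of u x] uv xy by simp
  next
    case 3
    moreover have u: "u = 1 - v" and "v \<le> 1" using uv by simp_all
    ultimately show ?thesis
      using convex_onD[OF powr_convex[OF p], of v x y] uv(2) unfolding u by simp
  qed
qed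

text \<open>The common form of the Ky Fan norm and the vector norm for a finite exponent.\<close>

definition pnorm :: "real \<Rightarrow> nat \<Rightarrow> (nat \<Rightarrow> real) \<Rightarrow> real" where
  "pnorm p k x = (\<Sum>i<k. \<bar>x i\<bar> powr p) powr (1 / p)"

lemma pnorm_powr:
  assumes "1 \<le> p"
  shows "pnorm p k x powr p = (\<Sum>i<k. \<bar>x i\<bar> powr p)"
  using assms by (simp add: pnorm_def powr_powr sum_nonneg)

lemma pnorm_le:
  assumes p: "1 \<le> p" and c: "0 \<le> c" and le: "(\<Sum>i<k. \<bar>x i\<bar> powr p) \<le> c powr p"
  shows "pnorm p k x \<le> c"
proof -
  have "pnorm p k x \<le> (c powr p) powr (1 / p)"
    unfolding pnorm_def using p le by (intro powr_mono2) (auto intro: sum_nonneg)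
  also have "\<dots> = c" using p c by (simp add: powr_powr)
  finally show ?thesis .
qed

lemma pnorm_mono:
  assumes p: "1 \<le> p" and le: "\<And>i. i < k \<Longrightarrow> \<bar>x i\<bar> \<le> \<bar>y i\<bar>"
  shows "pnorm p k x \<le> pnorm p k y"
  unfolding pnorm_def using assms by (intro powr_mono2 sum_mono) (auto intro: sum_nonneg)

text \<open>Minkowski's inequality. The sum is \<open>\<parallel>x\<parallel> + \<parallel>y\<parallel>\<close> times a convex combination of the normalised vectors
  \<open>x / \<parallel>x\<parallel>\<close> and \<open>y / \<parallel>y\<parallel>\<close>, and the unit ball is convex.\<close>

lemma pnorm_triangle:
  assumes p: "1 \<le> p"
  shows "pnorm p k (\<lambda>i. x i + y i) \<le> pnorm p k x + pnorm p k y"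
proof -
  let ?a = "pnorm p k x" and ?b = "pnorm p k y"
  have nonneg: "0 \<le> ?a" "0 \<le> ?b" by (auto simp: pnorm_def)
  have zero: "z i = 0" if "pnorm p k z = 0" "i < k" for z :: "nat \<Rightarrow> real" and i
  proof -
    have "(\<Sum>i<k. \<bar>z i\<bar> powr p) = 0" using that(1) pnorm_powr[OF p, of k z] p by simp
    then show ?thesis using that(2) by (simp add: sum_nonneg_eq_0_iff)
  qed
  consider "?a = 0" | "?b = 0" | "0 < ?a" "0 < ?b" using nonneg by linarith
  then show ?thesis
  proof cases
    case 1
    then have "pnorm p k (\<lambda>i. x i + y i) \<le> ?b" using zero[OF 1] by (intro pnorm_mono p) simp
    then show ?thesis using 1 by simp
  next
    case 2
    then have "pnorm p k (\<lambda>i. x i + y i) \<le> ?a" using zero[OF 2] by (intro pnorm_mono p) simp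
    then show ?thesis using 2 by simp
  next
    case 3
    let ?s = "?a + ?b"
    have s: "0 < ?s" using 3 by simp
    have unit: "(\<Sum>i<k. (\<bar>z i\<bar> / pnorm p k z) powr p) = 1" if "0 < pnorm p k z" for z
    proof -
      have "(\<Sum>i<k. (\<bar>z i\<bar> / pnorm p k z) powr p) = (\<Sum>i<k. \<bar>z i\<bar> powr p) / pnorm p k z powr p"
        using that by (simp add: powr_divide sum_divide_distrib)
      then show ?thesis using that by (simp add: pnorm_powr[OF p, symmetric])
    qed
    show ?thesis
    proof (rule pnorm_le[OF p])
      show "0 \<le> ?s" using s by simp
      have "(\<Sum>i<k. \<bar>x i + y i\<bar> powr p)
          \<le> (\<Sum>i<k. ?s powr p * (?a / ?s * (\<bar>x i\<bar> / ?a) powr p + ?b / ?s * (\<bar>y i\<bar> / ?b) powr p))"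
      proof (rule sum_mono)
        fix i
        have "\<bar>x i + y i\<bar> powr p \<le> (\<bar>x i\<bar> + \<bar>y i\<bar>) powr p"
          using p by (intro powr_mono2) auto
        also have "\<bar>x i\<bar> + \<bar>y i\<bar> = ?s * (?a / ?s * (\<bar>x i\<bar> / ?a) + ?b / ?s * (\<bar>y i\<bar> / ?b))"
        proof -
          have "S * (a / S * (c / a) + b / S * (d / b)) = c + d"
            if "0 < a" "0 < b" "0 < S" for a b c d S :: real
            using that by (simp add: field_simps)
          then show ?thesis using 3 s by simp
        qed
        also have "\<dots> powr p = ?s powr p * (?a / ?s * (\<bar>x i\<bar> / ?a) + ?b / ?s * (\<bar>y i\<bar> / ?b)) powr p"
          by (rule powr_mult)
        also have "\<dots> \<le> ?s powr p * (?a / ?s * (\<bar>x i\<bar> / ?a) powr p + ?b / ?s * (\<bar>y i\<bar> / ?b) powr p)"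
          using 3 s p by (intro mult_left_mono powr_convex_combination)
             (auto simp: add_divide_distrib[symmetric])
        finally show "\<bar>x i + y i\<bar> powr p
            \<le> ?s powr p * (?a / ?s * (\<bar>x i\<bar> / ?a) powr p + ?b / ?s * (\<bar>y i\<bar> / ?b) powr p)" .
      qed
      also have "\<dots> = ?s powr p * (?a / ?s * (\<Sum>i<k. (\<bar>x i\<bar> / ?a) powr p)
          + ?b / ?s * (\<Sum>i<k. (\<bar>y i\<bar> / ?b) powr p))"
        by (simp only: sum_distrib_left[symmetric] sum.distrib)
      also have "\<dots> = ?s powr p" using 3 s by (simp add: unit add_divide_distrib[symmetric])
      finally show "(\<Sum>i<k. \<bar>x i + y i\<bar> powr p) \<le> ?s powr p" .
    qed
  qed
qed

lemma pnorm_lipschitz: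
  assumes p: "1 \<le> p" and e: "\<And>i. i < k \<Longrightarrow> \<bar>x i - y i\<bar> \<le> e"
  shows "\<bar>pnorm p k x - pnorm p k y\<bar> \<le> real k * e"
proof (cases "k = 0")
  case False
  have e0: "0 \<le> e" using e[of 0] False by (meson abs_ge_zero gr0I order_trans)
  have one: "pnorm p k z \<le> real k * e" if "\<And>i. i < k \<Longrightarrow> \<bar>z i\<bar> \<le> e" for z
  proof (rule pnorm_le[OF p])
    show "0 \<le> real k * e" using e0 by simp
    have "(\<Sum>i<k. \<bar>z i\<bar> powr p) \<le> (\<Sum>i<k. e powr p)"
      using that p by (intro sum_mono powr_mono2) auto
    also have "\<dots> = real k powr 1 * e powr p" using False by simp
    also have "\<dots> \<le> real k powr p * e powr p"
      using p False by (intro mult_right_mono powr_mono) auto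
    also have "\<dots> = (real k * e) powr p" using e0 by (simp add: powr_mult)
    finally show "(\<Sum>i<k. \<bar>z i\<bar> powr p) \<le> (real k * e) powr p" .
  qed
  have "pnorm p k x \<le> pnorm p k y + pnorm p k (\<lambda>i. x i - y i)"
    using pnorm_triangle[OF p, of k y "\<lambda>i. x i - y i"] by simp
  moreover have "pnorm p k y \<le> pnorm p k x + pnorm p k (\<lambda>i. y i - x i)"
    using pnorm_triangle[OF p, of k x "\<lambda>i. y i - x i"] by simp
  moreover have "pnorm p k (\<lambda>i. x i - y i) \<le> real k * e" "pnorm p k (\<lambda>i. y i - x i) \<le> real k * e"
    using e by (auto intro!: one simp: abs_minus_commute)
  ultimately show ?thesis by linarith
qed (simp add: pnorm_def)

section \<open>Gateaux derivatives and the order of dual numbers\<close>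

text \<open>The set of limits, from which the definite description selects, is the same for both functions.\<close>

lemma Lim_cong_if_difference_vanishes:
  fixes f g :: "'a \<Rightarrow> real"
  assumes "((\<lambda>t. f t - g t) \<longlongrightarrow> 0) F"
  shows "Lim F f = Lim F g"
proof -
  have "(f \<longlongrightarrow> l) F \<longleftrightarrow> (g \<longlongrightarrow> l) F" for l
    using tendsto_add[OF assms, of g l] tendsto_diff[of f l F "\<lambda>t. f t - g t" 0] assms by auto
  then show ?thesis by (simp add: Topological_Spaces.Lim_def)
qed

lemma gateaux_deriv_cong_to_first_order:
  fixes f :: "'a::plus \<Rightarrow> real" and g :: "'b::plus \<Rightarrow> real"
  assumes base: "f x = g y"
    and close: "\<forall>\<^sub>F t in at_right 0. \<bar>f (x + sc t u) - g (y + sc' t w)\<bar> \<le> K * t\<^sup>2"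
  shows "gateaux_deriv sc f u x = gateaux_deriv sc' g w y"
  unfolding gateaux_deriv_def
proof (rule Lim_cong_if_difference_vanishes, rule tendsto_rabs_zero_cancel,
    rule tendsto_sandwich[of "\<lambda>_. 0" _ _ "\<lambda>t. K * t"])
  have "\<forall>\<^sub>F t::real in at_right 0. 0 < t" by (rule eventually_at_right_less)
  with close show "\<forall>\<^sub>F t in at_right 0.
      \<bar>(f (x + sc t u) - f x) / t - (g (y + sc' t w) - g y) / t\<bar> \<le> K * t"
  proof eventually_elim
    case (elim t)
    have "(f (x + sc t u) - f x) / t - (g (y + sc' t w) - g y) / t
        = (f (x + sc t u) - g (y + sc' t w)) / t"
      by (simp add: base diff_divide_distrib)
    then show ?case using elim by (simp add: abs_divide divide_le_eq power2_eq_square mult.assoc)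
  qed
  have "((\<lambda>t. K * t) \<longlongrightarrow> K * 0) (at_right 0)" by (intro tendsto_intros)
  then show "((\<lambda>t. K * t) \<longlongrightarrow> 0) (at_right 0)" by simp
qed auto

lemma eventually_lexicographic_nonneg:
  fixes d d' :: real
  assumes "0 < d \<or> d = 0 \<and> 0 \<le> d'"
  shows "\<forall>\<^sub>F t in at_right 0. 0 \<le> d + t * d'"
proof (cases "0 < d")
  case True
  have "((\<lambda>t. d + t * d') \<longlongrightarrow> d + 0 * d') (at_right 0)" by (intro tendsto_intros)
  then have "\<forall>\<^sub>F t in at_right 0. 0 < d + t * d'" using True by (auto dest: order_tendstoD)
  then show ?thesis by (rule eventually_mono) simp
next
  case False
  with assms have "d = 0" "0 \<le> d'" by auto
  have "\<forall>\<^sub>F t::real in at_right 0. 0 < t" by (rule eventually_at_right_less)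
  then show ?thesis by (rule eventually_mono) (use \<open>d = 0\<close> \<open>0 \<le> d'\<close> in simp)
qed

text \<open>The lexicographic order of dual numbers is the order of the germs \<open>t \<mapsto> x\<^sub>s + t x\<^sub>i\<close> at \<open>0\<close> from the
  right.\<close>

lemma eventually_dual_le:
  assumes "x \<le> y"
  shows "\<forall>\<^sub>F t in at_right 0. std_part x + t * inf_part x \<le> std_part y + t * inf_part y"
proof -
  have "\<forall>\<^sub>F t in at_right 0. 0 \<le> (std_part y - std_part x) + t * (inf_part y - inf_part x)"
    using assms by (intro eventually_lexicographic_nonneg) (auto simp: less_eq_dual_def less_dual_def)
  then show ?thesis by (rule eventually_mono) (simp add: algebra_simps)
qed

lemma std_part_mono: "x \<le> y \<Longrightarrow> std_part x \<le> std_part y"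
  by (auto simp: less_eq_dual_def less_dual_def)

section \<open>Singular values of a dual matrix with a compact decomposition\<close>

lemma parts_0 [simp]: "std_part 0 = 0" "inf_part 0 = 0"
  by (simp_all add: zero_dual_def)

lemma parts_1 [simp]: "std_part 1 = 1" "inf_part 1 = 0"
  by (simp_all add: one_dual_def)

lemma parts_add: "std_part (x + y) = std_part x + std_part y"
  "inf_part (x + y) = inf_part x + inf_part y"
  by (simp_all add: plus_dual_def)

lemma parts_mult: "std_part (x * y) = std_part x * std_part y"
  "inf_part (x * y) = std_part x * inf_part y + inf_part x * std_part y"
  by (simp_all add: times_dual_def)

lemma parts_sum: "std_part (sum f I) = (\<Sum>i\<in>I. std_part (f i))"
  "inf_part (sum f I) = (\<Sum>i\<in>I. inf_part (f i))"
  by (induction I rule: infinite_finite_induct; simp add: parts_add)+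

text \<open>The parts of \<open>Y\<^sup>T Y = 1\<close>, for reindexed columns: sorting the diagonal of the middle factor permutes
  the columns of the outer ones.\<close>

lemma dual_orthonormal_columns:
  assumes Y: "Y \<in> carrier_mat m r" "Y\<^sup>T * Y = 1\<^sub>m r" and pi: "inj_on \<pi> {..<r}" "\<pi> ` {..<r} \<subseteq> {..<r}"
    and l: "l < r" "l' < r"
  shows "dot m (\<lambda>i. std_part (Y $$ (i, \<pi> l))) (\<lambda>i. std_part (Y $$ (i, \<pi> l'))) = (if l = l' then 1 else 0)"
    and "dot m (\<lambda>i. std_part (Y $$ (i, \<pi> l))) (\<lambda>i. inf_part (Y $$ (i, \<pi> l')))
      + dot m (\<lambda>i. inf_part (Y $$ (i, \<pi> l))) (\<lambda>i. std_part (Y $$ (i, \<pi> l'))) = 0"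
proof -
  have bound: "\<pi> l < r" "\<pi> l' < r" using pi(2) l by auto
  have "(\<Sum>i<m. Y $$ (i, \<pi> l) * Y $$ (i, \<pi> l')) = (Y\<^sup>T * Y) $$ (\<pi> l, \<pi> l')"
    using Y(1) bound by (simp add: scalar_prod_def lessThan_atLeast0)
  also have "\<dots> = (if l = l' then 1 else 0)"
    using Y(2) bound pi(1) l by (auto dest: inj_onD)
  finally have eq: "(\<Sum>i<m. Y $$ (i, \<pi> l) * Y $$ (i, \<pi> l')) = (if l = l' then 1 else 0)" .
  show "dot m (\<lambda>i. std_part (Y $$ (i, \<pi> l))) (\<lambda>i. std_part (Y $$ (i, \<pi> l'))) = (if l = l' then 1 else 0)"
    using arg_cong[OF eq, of std_part] by (simp add: dot_def parts_sum parts_mult split: if_splits)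
  show "dot m (\<lambda>i. std_part (Y $$ (i, \<pi> l))) (\<lambda>i. inf_part (Y $$ (i, \<pi> l')))
      + dot m (\<lambda>i. inf_part (Y $$ (i, \<pi> l))) (\<lambda>i. std_part (Y $$ (i, \<pi> l'))) = 0"
    using arg_cong[OF eq, of inf_part] by (simp add: dot_def parts_sum parts_mult sum.distrib split: if_splits)
qed

lemma diagonal_factorisation_entry:
  fixes U S V :: "'a::comm_ring_1 mat"
  assumes "U \<in> carrier_mat m r" "S \<in> carrier_mat r r" "V \<in> carrier_mat n r" "diagonal_mat S"
    and "a < m" "b < n"
  shows "(U * S * V\<^sup>T) $$ (a, b) = (\<Sum>l<r. U $$ (a, l) * S $$ (l, l) * V $$ (b, l))"
proof -
  define W where "W = U * S"
  have W: "W \<in> carrier_mat m r" using assms by (simp add: W_def)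
  have US: "W $$ (a, l) = U $$ (a, l) * S $$ (l, l)" if "l < r" for l
  proof -
    have "W $$ (a, l) = (\<Sum>q<r. U $$ (a, q) * S $$ (q, l))"
      using assms that by (simp add: W_def scalar_prod_def lessThan_atLeast0)
    also have "\<dots> = (\<Sum>q<r. if q = l then U $$ (a, l) * S $$ (l, l) else 0)"
      using assms that by (intro sum.cong) (auto simp: diagonal_mat_def)
    finally show ?thesis using that by simp
  qed
  have "(W * V\<^sup>T) $$ (a, b) = (\<Sum>l<r. W $$ (a, l) * V $$ (b, l))"
    using assms W by (simp add: scalar_prod_def lessThan_atLeast0)
  also have "\<dots> = (\<Sum>l<r. U $$ (a, l) * S $$ (l, l) * V $$ (b, l))"
    using US by (intro sum.cong) auto
  finally show ?thesis unfolding W_def .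
qed

text \<open>The diagonal of \<open>S\<close> comes in any order. Sorting it by a permutation \<open>\<pi>\<close>, and permuting the columns
  of \<open>U\<close> and \<open>V\<close> by the same \<open>\<pi>\<close>, keeps the product and the orthonormality, so that the real
  perturbation estimate applies to the sorted values.\<close>

lemma CDSVD_singular_values:
  assumes A: "A \<in> carrier_mat m n" and r: "r = vec_space.rank m (map_mat std_part A)"
    and svd: "is_CDSVD A U S V"
  defines "\<sigma> \<equiv> dual_singular_values S"
  obtains K where "\<forall>t\<in>{0..1}. (\<forall>l<r. 0 \<le> std_part (\<sigma> ! l) + t * inf_part (\<sigma> ! l)) \<longrightarrow>
      (\<forall>l'<r. \<forall>l\<le>l'. std_part (\<sigma> ! l') + t * inf_part (\<sigma> ! l') \<le> std_part (\<sigma> ! l) + t * inf_part (\<sigma> ! l)) \<longrightarrow>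
      (\<forall>j<r. j < n \<and> \<bar>singular_values (map_mat std_part A + t \<cdot>\<^sub>m map_mat inf_part A) ! j
        - (std_part (\<sigma> ! j) + t * inf_part (\<sigma> ! j))\<bar> \<le> K * t\<^sup>2)"
    and "\<And>l. l < r \<Longrightarrow> 0 < \<sigma> ! l"
    and "\<And>l l'. l \<le> l' \<Longrightarrow> l' < r \<Longrightarrow> \<sigma> ! l' \<le> \<sigma> ! l"
proof -
  have U: "U \<in> carrier_mat m r" "U\<^sup>T * U = 1\<^sub>m r" and V: "V \<in> carrier_mat n r" "V\<^sup>T * V = 1\<^sub>m r"
    and S: "S \<in> carrier_mat r r" "diagonal_mat S" "\<And>i. i < r \<Longrightarrow> 0 < S $$ (i, i)"
    and fact: "A = U * S * V\<^sup>T"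
    using svd A by (auto simp: is_CDSVD_def Let_def r)
  have len: "length (diag_mat S) = r" "length \<sigma> = r"
    using S(1) by (auto simp: diag_mat_def \<sigma>_def dual_singular_values_def)
  have "mset \<sigma> = mset (diag_mat S)" by (simp add: \<sigma>_def dual_singular_values_def)
  then obtain \<pi> where \<pi>: "\<pi> permutes {..<r}" "permute_list \<pi> (diag_mat S) = \<sigma>"
    using mset_eq_permutation len by metis
  have bound: "\<pi> l < r" if "l < r" for l using \<pi>(1) that by (metis lessThan_iff permutes_in_image)
  have \<sigma>: "\<sigma> ! l = S $$ (\<pi> l, \<pi> l)" if "l < r" for l
    using \<pi> that bound[OF that] S(1) len by (auto simp: permute_list_nth diag_mat_def simp flip: \<pi>(2))
  have inj: "inj_on \<pi> {..<r}" "\<pi> ` {..<r} \<subseteq> {..<r}"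
    using \<pi>(1) by (auto simp: permutes_inj_on permutes_image)
  have entry: "A $$ (a, b) = (\<Sum>l<r. U $$ (a, \<pi> l) * \<sigma> ! l * V $$ (b, \<pi> l))" if "a < m" "b < n" for a b
  proof -
    have "A $$ (a, b) = (\<Sum>l<r. U $$ (a, l) * S $$ (l, l) * V $$ (b, l))"
      unfolding fact using diagonal_factorisation_entry[OF U(1) S(1) V(1) S(2) that] .
    also have "\<dots> = (\<Sum>l<r. U $$ (a, \<pi> l) * S $$ (\<pi> l, \<pi> l) * V $$ (b, \<pi> l))"
      using sum.permute[OF \<pi>(1), of "\<lambda>l. U $$ (a, l) * S $$ (l, l) * V $$ (b, l)"] by (simp add: o_def)
    finally show ?thesis using \<sigma> by simp
  qed
  have "\<exists>K. \<forall>t\<in>{0..1}. (\<forall>l<r. 0 \<le> std_part (\<sigma> ! l) + t * inf_part (\<sigma> ! l)) \<longrightarrow>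
      (\<forall>l'<r. \<forall>l\<le>l'. std_part (\<sigma> ! l') + t * inf_part (\<sigma> ! l') \<le> std_part (\<sigma> ! l) + t * inf_part (\<sigma> ! l)) \<longrightarrow>
      (\<forall>j<r. j < n \<and> \<bar>singular_values (map_mat std_part A + t \<cdot>\<^sub>m map_mat inf_part A) ! j
        - (std_part (\<sigma> ! j) + t * inf_part (\<sigma> ! j))\<bar> \<le> K * t\<^sup>2)"
  proof (rule singular_value_first_order[where Xs = "map_mat std_part A" and Xi = "map_mat inf_part A"
        and m = m and n = n and r = r
        and Us = "\<lambda>a l. std_part (U $$ (a, \<pi> l))" and Ui = "\<lambda>a l. inf_part (U $$ (a, \<pi> l))"
        and ss = "\<lambda>l. std_part (\<sigma> ! l)" and si = "\<lambda>l. inf_part (\<sigma> ! l)"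
        and Vs = "\<lambda>b l. std_part (V $$ (b, \<pi> l))" and Vi = "\<lambda>b l. inf_part (V $$ (b, \<pi> l))"],
        goal_cases)
    case (2 a b)
    then show ?case using A entry[of a b] by (simp add: parts_sum parts_mult)
  next
    case (4 a b)
    then show ?case using A entry[of a b] by (simp add: parts_sum parts_mult algebra_simps)
  qed (use A dual_orthonormal_columns[OF U inj] dual_orthonormal_columns[OF V inj] in auto)
  then obtain K where K: "\<forall>t\<in>{0..1}. (\<forall>l<r. 0 \<le> std_part (\<sigma> ! l) + t * inf_part (\<sigma> ! l)) \<longrightarrow>
      (\<forall>l'<r. \<forall>l\<le>l'. std_part (\<sigma> ! l') + t * inf_part (\<sigma> ! l') \<le> std_part (\<sigma> ! l) + t * inf_part (\<sigma> ! l)) \<longrightarrow>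
      (\<forall>j<r. j < n \<and> \<bar>singular_values (map_mat std_part A + t \<cdot>\<^sub>m map_mat inf_part A) ! j
        - (std_part (\<sigma> ! j) + t * inf_part (\<sigma> ! j))\<bar> \<le> K * t\<^sup>2)" by blast
  have "sorted (rev \<sigma>)" by (simp add: \<sigma>_def dual_singular_values_def)
  then have dec: "\<sigma> ! l' \<le> \<sigma> ! l" if "l \<le> l'" "l' < r" for l l'
    using that len(2) by (simp add: sorted_rev_iff_nth_mono)
  have pos: "0 < \<sigma> ! l" if "l < r" for l using \<sigma>[OF that] S(3)[OF bound[OF that]] by simp
  show ?thesis
    by (rule that[OF K pos dec])
qed

section \<open>Ky Fan norms of dual matrices\<close>

lemma Max_abs_eq_first:
  fixes y :: "nat \<Rightarrow> real"
  assumes "1 \<le> k" and "\<And>i. i < k \<Longrightarrow> 0 \<le> y i" and "\<And>i. i < k \<Longrightarrow> y i \<le> y 0"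
  shows "Max ((\<lambda>i. \<bar>y i\<bar>) ` {..<k}) = y 0"
  using assms by (intro Max_eqI) (auto simp: image_iff intro!: bexI[of _ 0])

lemma ky_fan_norm_close_to_vec_p_norm:
  fixes y :: "real Matrix.vec"
  assumes p: "1 \<le> p" and k: "1 \<le> k" and y: "dim_vec y = k"
    and nonneg: "\<And>i. i < k \<Longrightarrow> 0 \<le> y $ i" and max: "\<And>i. i < k \<Longrightarrow> y $ i \<le> y $ 0"
    and X: "X \<in> carrier_mat m n" "k \<le> n"
    and close: "\<And>i. i < k \<Longrightarrow> \<bar>singular_values X ! i - y $ i\<bar> \<le> e"
  shows "\<bar>ky_fan_norm k p X - vec_p_norm p y\<bar> \<le> real k * e"
proof (cases "p = \<infinity>")
  case True
  have "Max ((\<lambda>i. \<bar>y $ i\<bar>) ` {..<dim_vec y}) = y $ 0"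
    unfolding y using k nonneg max by (rule Max_abs_eq_first)
  then have "\<bar>ky_fan_norm k p X - vec_p_norm p y\<bar> \<le> e"
    using close[of 0] k True by (simp add: ky_fan_norm_def vec_p_norm_def)
  moreover have "1 * e \<le> real k * e"
    using k close[of 0] by (intro mult_right_mono) auto
  ultimately show ?thesis by simp
next
  case False
  define q where "q = real_of_ereal p"
  have q: "1 \<le> q" using p False by (cases p) (auto simp: q_def)
  have "ky_fan_norm k p X = pnorm q k (\<lambda>i. singular_values X ! i)"
    using singular_value_nonneg[OF X(1)] X(2) False
    by (simp add: ky_fan_norm_def pnorm_def q_def)
  moreover have "vec_p_norm p y = pnorm q k (\<lambda>i. y $ i)"
    using False y by (simp add: vec_p_norm_def pnorm_def q_def)
  ultimately show ?thesis using pnorm_lipschitz[OF q close] by simp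
qed

theorem theorem5p20:
  fixes A U S V :: "dual mat" and m n r k :: nat and p :: ereal
  assumes "n \<le> m"
    and "A \<in> carrier_mat m n"
    and "r = vec_space.rank m (map_mat std_part A)"
    and "is_CDSVD A U S V"
    and "1 \<le> p"
    and "1 \<le> k" and "k \<le> r"
  shows "dual_ky_fan_norm k p A = dual_vec_p_norm p (leading_vec k (dual_singular_values S))"
proof -
  \<comment> \<open>\<open>X\<close> and \<open>y\<close> are the two real lines along which the norms are differentiated.\<close>
  define \<sigma> where "\<sigma> = dual_singular_values S"
  define \<sigma>k where "\<sigma>k = leading_vec k \<sigma>"
  let ?s = "\<lambda>t i. std_part (\<sigma> ! i) + t * inf_part (\<sigma> ! i)"
  define X where "X t = map_mat std_part A + t \<cdot>\<^sub>m map_mat inf_part A" for t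
  define y where "y t = map_vec std_part \<sigma>k + t \<cdot>\<^sub>v map_vec inf_part \<sigma>k" for t
  obtain K where K: "\<forall>t\<in>{0..1}. (\<forall>l<r. 0 \<le> ?s t l) \<longrightarrow>
      (\<forall>l'<r. \<forall>l\<le>l'. ?s t l' \<le> ?s t l) \<longrightarrow>
      (\<forall>j<r. j < n \<and> \<bar>singular_values (X t) ! j - ?s t j\<bar> \<le> K * t\<^sup>2)"
    and pos: "\<And>l. l < r \<Longrightarrow> 0 < \<sigma> ! l"
    and dec: "\<And>l l'. l \<le> l' \<Longrightarrow> l' < r \<Longrightarrow> \<sigma> ! l' \<le> \<sigma> ! l"
    using CDSVD_singular_values[OF assms(2-4)] unfolding \<sigma>_def X_def by blast
  have X: "X t \<in> carrier_mat m n" for t using assms(2) by (simp add: X_def)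
  have y: "dim_vec (y t) = k" "\<And>i. i < k \<Longrightarrow> y t $ i = ?s t i" for t
    by (auto simp: y_def \<sigma>k_def leading_vec_def)
  have close: "\<bar>ky_fan_norm k p (X t) - vec_p_norm p (y t)\<bar> \<le> real k * (K * t\<^sup>2)"
    if t: "t \<in> {0..1}" and p_t: "\<forall>l<r. 0 \<le> ?s t l" and d_t: "\<forall>l'<r. \<forall>l\<le>l'. ?s t l' \<le> ?s t l" for t
  proof -
    have sv: "j < n \<and> \<bar>singular_values (X t) ! j - ?s t j\<bar> \<le> K * t\<^sup>2" if "j < r" for j
      using K t p_t d_t that by blast
    have "k - 1 < n" using sv[of "k - 1"] assms(6,7) by simp
    then have "k \<le> n" by simp
    then show ?thesis
      using sv p_t d_t assms(6,7) y
      by (intro ky_fan_norm_close_to_vec_p_norm[OF assms(5,6) _ _ _ X]) auto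
  qed
  \<comment> \<open>At \<open>t = 0\<close> the error term of the estimate vanishes, so the standard parts agree exactly.\<close>
  have base: "ky_fan_norm k p (X 0) = vec_p_norm p (y 0)"
  proof -
    have "\<forall>l<r. 0 \<le> ?s 0 l"
      using std_part_mono[of 0] pos by (force intro: less_imp_le)
    moreover have "\<forall>l'<r. \<forall>l\<le>l'. ?s 0 l' \<le> ?s 0 l"
      using std_part_mono[OF dec] by simp
    ultimately show ?thesis using close[of 0] by simp
  qed
  have zero: "X 0 = map_mat std_part A" "y 0 = map_vec std_part \<sigma>k"
    using assms(2) by (auto simp: X_def y_def intro!: eq_matI)
  have "\<forall>\<^sub>F t in at_right 0. \<forall>l\<in>{..<r}. 0 \<le> ?s t l"
  proof (rule eventually_ball_finite, simp, rule ballI)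
    fix l assume "l \<in> {..<r}"
    then have "0 \<le> \<sigma> ! l" using pos[of l] by simp
    from eventually_dual_le[OF this] show "\<forall>\<^sub>F t in at_right 0. 0 \<le> ?s t l" by simp
  qed
  moreover have "\<forall>\<^sub>F t in at_right 0. \<forall>l'\<in>{..<r}. \<forall>l\<in>{..l'}. ?s t l' \<le> ?s t l"
    by (intro eventually_ball_finite ballI eventually_dual_le) (auto intro: dec)
  moreover have "\<forall>\<^sub>F t::real in at_right 0. t \<in> {0<..<1}"
    by (rule eventually_at_rightI[of 0 1]) auto
  ultimately have "\<forall>\<^sub>F t in at_right 0.
      \<bar>ky_fan_norm k p (X t) - vec_p_norm p (y t)\<bar> \<le> (real k * K) * t\<^sup>2"
  proof eventually_elim
    case (elim t)
    have "t \<in> {0..1}" "\<forall>l<r. 0 \<le> ?s t l" "\<forall>l'<r. \<forall>l\<le>l'. ?s t l' \<le> ?s t l"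
      using elim by auto
    from close[OF this] show ?case by (simp add: mult.assoc)
  qed
  then have "gateaux_deriv (\<cdot>\<^sub>m) (ky_fan_norm k p) (map_mat inf_part A) (map_mat std_part A)
      = gateaux_deriv (\<cdot>\<^sub>v) (vec_p_norm p) (map_vec inf_part \<sigma>k) (map_vec std_part \<sigma>k)"
    using base unfolding zero unfolding X_def y_def by (rule gateaux_deriv_cong_to_first_order[rotated])
  then show ?thesis
    using base unfolding zero
    by (simp add: dual_ky_fan_norm_def dual_vec_p_norm_def dual_continuation_def \<sigma>k_def \<sigma>_def)
qed

end
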